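(* Let $T_t$ be a uniformly bounded one-parameter semigroup acting on a complex Banach space $\mathcal{B}$, with an unbounded generator $A$. Let $f\in L^1(0,\infty)$ and $$X_f=\int_0^\infty f(t)T_t\,dt,$$ where the integral converges strongly in $\mathcal{L}(\mathcal{B})$. Put $$\hat f(z)=\int_0^\infty f(t)e^{zt}\,dt$$ for all $z$ satisfying $\mathrm{Re}(z)\le 0$. Then $$\mathrm{Spec}(X_f)=\{0\}\cup\{\hat f(\lambda):\lambda\in\mathrm{Spec}(A)\}.$$
   Context: A one-parameter semigroup is a strongly continuous semigroup $(T_t)_{t\ge 0}$ of bounded operators on $\mathcal{B}$ with $T_0=I$; uniformly bounded means $\sup_{t\ge 0}\|T_t\|<\infty$. $\mathcal{L}(\mathcal{B})$ is the algebra of bounded operators on $\mathcal{B}$. Functions in $L^1(0,\infty)$ are complex-valued. *)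

theory Defs
  imports "HOL-Analysis.Analysis"
begin

class complex_normed_vector = real_normed_vector +
  fixes scaleC :: "complex \<Rightarrow> 'a \<Rightarrow> 'a"  (infixr \<open>*\<^sub>C\<close> 75)
  assumes scaleC_add_right: "a *\<^sub>C (x + y) = a *\<^sub>C x + a *\<^sub>C y"
    and scaleC_add_left: "(a + b) *\<^sub>C x = a *\<^sub>C x + b *\<^sub>C x"
    and scaleC_scaleC: "a *\<^sub>C b *\<^sub>C x = (a * b) *\<^sub>C x"
    and scaleR_scaleC: "r *\<^sub>R x = complex_of_real r *\<^sub>C x"
    and norm_scaleC: "norm (a *\<^sub>C x) = cmod a * norm x"

class complex_banach = complex_normed_vector + banach

instantiation complex :: complex_banach
begin

definition scaleC_complex :: "complex \<Rightarrow> complex \<Rightarrow> complex" where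
  "scaleC_complex = (*)"

instance
  by standard
    (simp_all add: scaleC_complex_def algebra_simps norm_mult scaleR_conv_of_real)

end

definition bounded_clinear :: "('a::complex_normed_vector \<Rightarrow> 'a) \<Rightarrow> bool" where
  "bounded_clinear F \<longleftrightarrow> bounded_linear F \<and> (\<forall>c x. F (c *\<^sub>C x) = c *\<^sub>C F x)"

text \<open>A partially defined operator is a domain \<open>D\<close> together with a map \<open>A\<close> whose values off \<open>D\<close> are
  irrelevant. A point \<open>z\<close> is in the resolvent set when \<open>z - A\<close> maps \<open>D\<close> bijectively onto the whole
  space with bounded inverse. For \<open>D = UNIV\<close> and \<open>A\<close> bounded this is invertibility of \<open>z - A\<close> in the
  algebra of bounded operators.\<close>

definition Spec :: "'a::complex_normed_vector set \<Rightarrow> ('a \<Rightarrow> 'a) \<Rightarrow> complex set" where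
  "Spec D A = {z. \<not> (bij_betw (\<lambda>x. z *\<^sub>C x - A x) D UNIV \<and>
                     bounded_clinear (inv_into D (\<lambda>x. z *\<^sub>C x - A x)))}"

definition unbounded_operator :: "'a::complex_normed_vector set \<Rightarrow> ('a \<Rightarrow> 'a) \<Rightarrow> bool" where
  "unbounded_operator D A \<longleftrightarrow> \<not> (\<exists>C. \<forall>x\<in>D. norm (A x) \<le> C * norm x)"

text \<open>In the following, only the values \<open>T t\<close> for \<open>t \<ge> 0\<close> matter.\<close>

definition one_parameter_semigroup :: "(real \<Rightarrow> 'a::complex_normed_vector \<Rightarrow> 'a) \<Rightarrow> bool" where
  "one_parameter_semigroup T \<longleftrightarrow>
     (\<forall>t\<ge>0. bounded_clinear (T t)) \<and>
     T 0 = id \<and>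
     (\<forall>s\<ge>0. \<forall>t\<ge>0. T (s + t) = T s \<circ> T t) \<and>
     (\<forall>x. continuous_on {0..} (\<lambda>t. T t x))"

definition uniformly_bounded :: "(real \<Rightarrow> 'a::complex_normed_vector \<Rightarrow> 'a) \<Rightarrow> bool" where
  "uniformly_bounded T \<longleftrightarrow> bdd_above ((\<lambda>t. onorm (T t)) ` {0..})"

definition generator_domain :: "(real \<Rightarrow> 'a::complex_normed_vector \<Rightarrow> 'a) \<Rightarrow> 'a set" where
  "generator_domain T = {x. \<exists>y. ((\<lambda>t. (T t x - x) /\<^sub>R t) \<longlongrightarrow> y) (at_right 0)}"

definition generator :: "(real \<Rightarrow> 'a::complex_normed_vector \<Rightarrow> 'a) \<Rightarrow> 'a \<Rightarrow> 'a" where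
  "generator T x = Lim (at_right 0) (\<lambda>t. (T t x - x) /\<^sub>R t)"

text \<open>The Bochner integral of the library is confined to second countable, i.e. separable, spaces.
  The gauge integral used here is available in every Banach space and agrees with the Bochner
  (for complex-valued functions: Lebesgue) integral whenever the latter exists. The integral is
  taken pointwise in \<open>x\<close>, i.e. in the strong sense.\<close>

definition semigroup_integral ::
    "(real \<Rightarrow> complex) \<Rightarrow> (real \<Rightarrow> 'a::complex_normed_vector \<Rightarrow> 'a) \<Rightarrow> 'a \<Rightarrow> 'a" where
  "semigroup_integral f T x = integral {0<..} (\<lambda>t. f t *\<^sub>C T t x)"

text \<open>This is meant for \<open>Re z \<le> 0\<close>, where the integrand is absolutely integrable for
  integrable \<open>f\<close>.\<close>

definition laplace_hat :: "(real \<Rightarrow> complex) \<Rightarrow> complex \<Rightarrow> complex" where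
  "laplace_hat f z = integral {0<..} (\<lambda>t. f t * exp (z * complex_of_real t))"

end

theory Submission
  imports Defs "HOL-Computational_Algebra.Fundamental_Theorem_Algebra"
begin

text \<open>Let \<open>R = (1 - A)\<^sup>-\<^sup>1\<close> and \<open>K = Spec R\<close>, so that \<open>0 \<in> K\<close> because \<open>A\<close> is unbounded, and
  \<open>w \<mapsto> 1 - 1 / w\<close> maps \<open>K - {0}\<close> onto \<open>Spec A\<close>. By Weierstrass' theorem in the variable
  \<open>s = e\<^bsup>-t\<^esup>\<close> the function \<open>f\<close> is an \<open>L\<^sup>1\<close> limit of exponential sums \<open>\<Sum> c\<^sub>k e\<^bsup>-kt\<^esup>\<close> with \<open>k \<ge> 1\<close>.
  For these \<open>X\<^sub>f\<close> is the combination \<open>\<Sum> c\<^sub>k (k - A)\<^sup>-\<^sup>1\<close> of resolvents, a rational function of \<open>R\<close>,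
  and the spectral mapping theorem follows from the fundamental theorem of algebra. The passage to
  the limit is uniform on \<open>K\<close> and in operator norm, and it preserves the spectral mapping theorem
  because the spectra of commuting operators differ by at most the distance of the operators.\<close>

text \<open>The delicate half of the limit is to keep a point off the closed set of limit values out
  of Spec X_f. The resolvents of the approximants exist there, but their norms need not stay
  bounded, so norm perturbation alone does not carry invertibility over. What survives is a bound on
  spectral radii, and commutativity lets it absorb the small difference of the operators. Averaging
  over roots of unity of order a power of two controls the spectral radius, in place of Cauchy's
  integral formula for operator-valued functions. The exponents start at 1 because constants are not
  integrable on the half-line. Accordingly every symbol, a sum of terms c_k w / (1 + (k - 1) w),
  vanishes at w = 0. Under \<lambda> = 1 - 1/w this w stands for the point at infinity, and it
  produces the extra value 0 of the theorem. The semigroup takes values in an arbitrary Banach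
  space. Gauge integrability of f(t) T_t x is therefore derived from the Cauchy criterion, by
  approximating the scalar factor in L^1.\<close>

lemma bounded_clinearI:
  assumes "\<And>x y. F (x + y) = F x + F y" "\<And>c x. F (c *\<^sub>C x) = c *\<^sub>C F x"
    and "\<And>x. norm (F x) \<le> C * norm x"
  shows "bounded_clinear F"
  unfolding bounded_clinear_def
proof (intro conjI allI)
  show "bounded_linear F"
    using assms by (intro bounded_linear_intro[where K = C]) (auto simp: scaleR_scaleC mult.commute)
qed (fact assms(2))

lemma bounded_clinear_add: "bounded_clinear F \<Longrightarrow> F (x + y) = F x + F y"
  by (simp add: bounded_clinear_def linear_simps)

lemma bounded_clinear_diff: "bounded_clinear F \<Longrightarrow> F (x - y) = F x - F y"
  by (simp add: bounded_clinear_def linear_simps)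

lemma bounded_clinear_scaleC: "bounded_clinear F \<Longrightarrow> F (c *\<^sub>C x) = c *\<^sub>C F x"
  by (simp add: bounded_clinear_def)

lemma bounded_clinear_scaleR: "bounded_clinear F \<Longrightarrow> F (r *\<^sub>R x) = r *\<^sub>R F x"
  by (simp add: bounded_clinear_def linear_simps)

lemma bounded_clinear_bounded_linear: "bounded_clinear F \<Longrightarrow> bounded_linear F"
  by (simp add: bounded_clinear_def)

section \<open>Arithmetic of complex scalars\<close>

lemma scaleC_zero_left [simp]: "0 *\<^sub>C (x::'a::complex_normed_vector) = 0"
  using scaleC_add_left[of 0 0 x] by simp

lemma scaleC_zero_right [simp]: "c *\<^sub>C (0::'a::complex_normed_vector) = 0"
  using scaleC_add_right[of c 0 0] by simp

lemma scaleC_one [simp]: "1 *\<^sub>C (x::'a::complex_normed_vector) = x"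
  using scaleR_scaleC[of 1 x] by simp

lemma scaleC_minus_right [simp]: "c *\<^sub>C (- (x::'a::complex_normed_vector)) = - (c *\<^sub>C x)"
  using scaleC_add_right[of c x "- x"] by (simp add: eq_neg_iff_add_eq_0 add.commute)

lemma scaleC_minus_left [simp]: "(- c) *\<^sub>C (x::'a::complex_normed_vector) = - (c *\<^sub>C x)"
  using scaleC_add_left[of c "- c" x] by (simp add: eq_neg_iff_add_eq_0 add.commute)

lemma scaleC_diff_right: "c *\<^sub>C (x - y) = c *\<^sub>C (x::'a::complex_normed_vector) - c *\<^sub>C y"
  using scaleC_add_right[of c x "- y"] by simp

lemma scaleC_diff_left: "(a - b) *\<^sub>C (x::'a::complex_normed_vector) = a *\<^sub>C x - b *\<^sub>C x"
  using scaleC_add_left[of a "- b" x] by simp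

lemmas scaleC_algebra = scaleC_add_left scaleC_add_right scaleC_diff_left scaleC_diff_right
  scaleC_scaleC

lemma bounded_bilinear_scaleC: "bounded_bilinear (scaleC :: complex \<Rightarrow> 'a \<Rightarrow> 'a::complex_normed_vector)"
proof
  show "\<exists>K. \<forall>a (b::'a). norm (a *\<^sub>C b) \<le> norm a * norm b * K"
    by (rule exI[of _ 1]) (simp add: norm_scaleC)
  show "(r *\<^sub>R a) *\<^sub>C b = r *\<^sub>R (a *\<^sub>C b)" "a *\<^sub>C (r *\<^sub>R b) = r *\<^sub>R (a *\<^sub>C b)" for r a and b :: 'a
    by (simp_all add: scaleR_scaleC[where 'a = 'a] scaleC_scaleC scaleR_conv_of_real mult.commute)
qed (simp_all add: scaleC_algebra)

lemmas continuous_on_scaleC [continuous_intros] =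
  bounded_bilinear.continuous_on [OF bounded_bilinear_scaleC]
lemmas bounded_linear_scaleC_right = bounded_bilinear.bounded_linear_right [OF bounded_bilinear_scaleC]

section \<open>The algebra of bounded complex linear operators\<close>

typedef (overloaded) 'a cop = "{F :: 'a::complex_normed_vector \<Rightarrow> 'a. bounded_clinear F}"
  morphisms app Cop
  by (rule exI[of _ "\<lambda>x. x"]) (auto simp: bounded_clinear_def bounded_linear_ident)

setup_lifting type_definition_cop

lemma bounded_clinear_app [simp]: "bounded_clinear (app a)"
  using app by auto

lemma cop_eqI: "(\<And>x. app a x = app b x) \<Longrightarrow> a = b"
  by (simp add: app_inject[symmetric] fun_eq_iff)

lemmas app_linear = bounded_clinear_add[OF bounded_clinear_app] bounded_clinear_diff[OF bounded_clinear_app]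
  bounded_clinear_scaleC[OF bounded_clinear_app]

instantiation cop :: (complex_normed_vector) complex_normed_vector
begin

lift_definition zero_cop :: "'a cop" is "\<lambda>x. 0"
  by (simp add: bounded_clinear_def bounded_linear_zero)
lift_definition plus_cop :: "'a cop \<Rightarrow> 'a cop \<Rightarrow> 'a cop" is "\<lambda>F G x. F x + G x"
  by (auto simp: bounded_clinear_def bounded_linear_add scaleC_algebra)
lift_definition minus_cop :: "'a cop \<Rightarrow> 'a cop \<Rightarrow> 'a cop" is "\<lambda>F G x. F x - G x"
  by (auto simp: bounded_clinear_def bounded_linear_sub scaleC_algebra)
lift_definition uminus_cop :: "'a cop \<Rightarrow> 'a cop" is "\<lambda>F x. - F x"
  by (auto simp: bounded_clinear_def bounded_linear_minus)
lift_definition scaleC_cop :: "complex \<Rightarrow> 'a cop \<Rightarrow> 'a cop" is "\<lambda>c F x. c *\<^sub>C F x"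
  by (auto simp: bounded_clinear_def scaleC_algebra mult.commute
      intro: bounded_linear_compose[OF bounded_linear_scaleC_right])
lift_definition scaleR_cop :: "real \<Rightarrow> 'a cop \<Rightarrow> 'a cop" is "\<lambda>c F x. c *\<^sub>R F x"
  by (auto simp: bounded_clinear_def scaleC_algebra scaleR_scaleC mult.commute
      intro: bounded_linear_compose[OF bounded_linear_scaleC_right])
lift_definition norm_cop :: "'a cop \<Rightarrow> real" is onorm .
definition dist_cop :: "'a cop \<Rightarrow> 'a cop \<Rightarrow> real" where "dist_cop a b = norm (a - b)"
definition sgn_cop :: "'a cop \<Rightarrow> 'a cop" where "sgn_cop a = scaleR (inverse (norm a)) a"
definition uniformity_cop :: "('a cop \<times> 'a cop) filter" where
  "uniformity_cop = (INF e\<in>{0 <..}. principal {(x, y). dist x y < e})"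
definition open_cop :: "'a cop set \<Rightarrow> bool" where
  "open_cop U \<longleftrightarrow> (\<forall>x\<in>U. \<forall>\<^sub>F (x', y) in uniformity. x' = x \<longrightarrow> y \<in> U)"

instance
proof
  fix a b c :: "'a cop" and r s :: real and y z :: complex
  show "a + b + c = a + (b + c)" "a + b = b + a" "0 + a = a" "- a + a = 0" "a - b = a + - b"
    by (transfer; simp add: fun_eq_iff algebra_simps)+
  show "r *\<^sub>R (a + b) = r *\<^sub>R a + r *\<^sub>R b" "(r + s) *\<^sub>R a = r *\<^sub>R a + s *\<^sub>R a"
    "r *\<^sub>R s *\<^sub>R a = (r * s) *\<^sub>R a" "1 *\<^sub>R a = a"
    by (transfer; simp add: fun_eq_iff algebra_simps)+
  show "z *\<^sub>C (a + b) = z *\<^sub>C a + z *\<^sub>C b" "(y + z) *\<^sub>C a = y *\<^sub>C a + z *\<^sub>C a"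
    "y *\<^sub>C z *\<^sub>C a = (y * z) *\<^sub>C a" "r *\<^sub>R a = complex_of_real r *\<^sub>C a"
    by (transfer; simp add: fun_eq_iff scaleC_algebra scaleR_scaleC)+
  show "sgn a = scaleR (inverse (norm a)) a" "dist a b = norm (a - b)"
    by (simp_all add: sgn_cop_def dist_cop_def)
  show "uniformity = (INF e\<in>{0 <..}. principal {(x, y). dist x (y::'a cop) < e})"
    by (rule uniformity_cop_def)
  show "open U \<longleftrightarrow> (\<forall>x\<in>U. \<forall>\<^sub>F (x', y) in uniformity. x' = x \<longrightarrow> y \<in> U)" for U :: "'a cop set"
    by (rule open_cop_def)
  show "norm a = 0 \<longleftrightarrow> a = 0"
    by transfer (auto simp: bounded_clinear_def onorm_eq_0)
  show "norm (a + b) \<le> norm a + norm b"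
    by transfer (auto simp: bounded_clinear_def onorm_triangle)
  show "norm (r *\<^sub>R a) = \<bar>r\<bar> * norm a"
    by transfer (auto simp: bounded_clinear_def onorm_scaleR)
  have le: "onorm (\<lambda>x. z *\<^sub>C F x) \<le> cmod z * onorm F" if "bounded_clinear F" for z and F :: "'a \<Rightarrow> 'a"
    using that by (intro onorm_bound)
      (auto simp: norm_scaleC bounded_clinear_def mult.assoc onorm onorm_pos_le intro!: mult_left_mono)
  have "onorm (\<lambda>x. z *\<^sub>C F x) = cmod z * onorm F" if F: "bounded_clinear F" for z and F :: "'a \<Rightarrow> 'a"
  proof (cases "z = 0")
    case True
    then show ?thesis by (simp add: onorm_zero)
  next
    case False
    have "bounded_clinear (\<lambda>x. z *\<^sub>C F x)"
      using F by (auto simp: bounded_clinear_def scaleC_algebra mult.commute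
          intro: bounded_linear_compose[OF bounded_linear_scaleC_right])
    \<comment> \<open>The reverse inequality is the same bound for the inverse scalar.\<close>
    from le[OF this, of "1 / z"] have "onorm F \<le> onorm (\<lambda>x. z *\<^sub>C F x) / cmod z"
      using False by (simp add: scaleC_scaleC norm_divide)
    with le[OF F, of z] False show ?thesis
      by (simp add: field_simps)
  qed
  then show "norm (z *\<^sub>C a) = cmod z * norm a"
    by transfer auto
qed

end

text \<open>A class with \<open>norm 1 = 1\<close> would exclude the zero space, on which
  \<open>1 = 0\<close>; hence the unit comes from \<open>monoid_mult\<close>, and its norm is only
  bounded by 1.\<close>

instantiation cop :: (complex_normed_vector) "{real_normed_algebra, monoid_mult}"
begin

lift_definition one_cop :: "'a cop" is "\<lambda>x. x"
  by (simp add: bounded_clinear_def bounded_linear_ident)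
lift_definition times_cop :: "'a cop \<Rightarrow> 'a cop \<Rightarrow> 'a cop" is "\<lambda>F G x. F (G x)"
  by (auto simp: bounded_clinear_def bounded_linear_compose)

instance
proof
  fix a b c :: "'a cop" and r :: real
  show "a * b * c = a * (b * c)" "1 * a = a" "a * 1 = a"
    by (transfer; simp)+
  show "(a + b) * c = a * c + b * c" "r *\<^sub>R a * b = r *\<^sub>R (a * b)"
    by (transfer; simp)+
  show "a * (b + c) = a * b + a * c" "a * r *\<^sub>R b = r *\<^sub>R (a * b)"
    by (transfer; simp add: bounded_clinear_add bounded_clinear_scaleR)+
  show "norm (a * b) \<le> norm a * norm b"
    by transfer (auto simp: bounded_clinear_def onorm_compose[unfolded o_def])
qed

end

lemma app_simps [simp]:
  "app 0 x = 0" "app 1 x = x" "app (a + b) x = app a x + app b x" "app (a - b) x = app a x - app b x"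
  "app (- a) x = - app a x" "app (a * b) x = app a (app b x)" "app (c *\<^sub>C a) x = c *\<^sub>C app a x"
  by (transfer; simp)+

lemma app_Cop: "bounded_clinear F \<Longrightarrow> app (Cop F) = F"
  by (simp add: Cop_inverse)

lemma cop_scaleC_mult [simp]:
  fixes a b :: "'a::complex_normed_vector cop"
  shows "(c *\<^sub>C a) * b = c *\<^sub>C (a * b)" "a * (c *\<^sub>C b) = c *\<^sub>C (a * b)"
  by (rule cop_eqI; simp add: app_linear)+

lemma norm_app: "norm (app a x) \<le> norm a * norm x"
  by transfer (auto simp: bounded_clinear_def onorm)

lemma norm_cop_le:
  assumes "\<And>x. norm (app a x) \<le> C * norm x" "0 \<le> C"
  shows "norm a \<le> C"
  using assms by transfer (auto intro: onorm_bound)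

lemma norm_cop_one_le: "norm (1::'a::complex_normed_vector cop) \<le> 1"
  by (rule norm_cop_le) auto

section \<open>Invertible operators\<close>

definition unit_op :: "'a::complex_normed_vector cop \<Rightarrow> bool" where
  "unit_op a \<longleftrightarrow> (\<exists>b. a * b = 1 \<and> b * a = 1)"

lemma unit_opI: "a * b = 1 \<Longrightarrow> c * a = 1 \<Longrightarrow> unit_op a"
  by (metis unit_op_def mult.assoc mult_1_left mult_1_right)

lemma unit_op_mult: "unit_op a \<Longrightarrow> unit_op b \<Longrightarrow> unit_op (a * b)"
  unfolding unit_op_def by (metis mult.assoc mult_1_left)

text \<open>If \<open>c\<close> inverts \<open>a * b\<close>, then \<open>b * c\<close> is a right
  inverse of \<open>a\<close> and, by commutativity, \<open>c * b\<close> is a left inverse.\<close>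

lemma unit_op_factor:
  assumes "unit_op (a * b)" "a * b = b * a"
  shows "unit_op a"
proof -
  obtain c where "a * b * c = 1" "c * (a * b) = 1"
    using assms by (auto simp: unit_op_def)
  then have "a * (b * c) = 1" "c * b * a = 1"
    by (metis mult.assoc assms(2))+
  then show ?thesis
    by (rule unit_opI)
qed

lemma unit_op_scaleC: "c \<noteq> 0 \<Longrightarrow> unit_op a \<Longrightarrow> unit_op (c *\<^sub>C a)"
  unfolding unit_op_def
  by (metis (no_types, lifting) cop_scaleC_mult scaleC_scaleC scaleC_one right_inverse left_inverse)

lemma Spec_UNIV_iff: "z \<in> Spec UNIV (app a) \<longleftrightarrow> \<not> unit_op (z *\<^sub>C 1 - a)"
proof -
  define b where "b = z *\<^sub>C 1 - a"
  have b: "(\<lambda>x. z *\<^sub>C x - app a x) = app b"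
    by (simp add: b_def fun_eq_iff)
  have "unit_op b \<longleftrightarrow> bij (app b) \<and> bounded_clinear (inv (app b))"
  proof
    assume "unit_op b"
    then obtain c where c: "b * c = 1" "c * b = 1"
      by (auto simp: unit_op_def)
    have *: "app b (app c x) = x" "app c (app b x) = x" for x
      using c by (metis app_simps(2,6))+
    then have "bij (app b)"
      by (metis bijI')
    moreover have "inv (app b) = app c"
      using * by (metis inv_unique_comp comp_def id_apply ext)
    ultimately show "bij (app b) \<and> bounded_clinear (inv (app b))"
      by simp
  next
    assume *: "bij (app b) \<and> bounded_clinear (inv (app b))"
    then have "b * Cop (inv (app b)) = 1" "Cop (inv (app b)) * b = 1"
      by (auto intro!: cop_eqI simp: app_Cop bij_is_surj surj_f_inv_f bij_is_inj)
    then show "unit_op b"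
      by (auto simp: unit_op_def)
  qed
  then show ?thesis
    by (simp add: Spec_def b) (simp add: b_def)
qed

text \<open>The Neumann series is replaced by Banach's fixed point theorem: the value of the inverse
  at \<open>y\<close> is the fixed point of the contraction \<open>x \<mapsto> y + app a x\<close>.
  Completeness thus enters through the underlying space, not through the operators.\<close>

lemma unit_op_one_minus:
  fixes a :: "'a::complex_banach cop"
  assumes "norm a < 1"
  shows "unit_op (1 - a)"
proof -
  have ex: "\<exists>!x. y + app a x = x" for y
    using assms norm_app[of a]
    by (intro banach_fix_type[of "norm a"]) (auto simp: dist_norm app_linear(2)[symmetric])
  define F where "F y = (THE x. y + app a x = x)" for y
  have F: "y + app a (F y) = F y" for y
    unfolding F_def using ex by (rule theI')
  \<comment> \<open>Uniqueness of the fixed point is the source of the linearity of \<open>F\<close>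
    and of the left inverse identity.\<close>
  have F_eq: "F y = x" if "y + app a x = x" for x y
    using ex F that by blast
  have "bounded_clinear F"
  proof (rule bounded_clinearI)
    show "F (x + y) = F x + F y" for x y
    proof (rule F_eq)
      have "x + y + app a (F x + F y) = (x + app a (F x)) + (y + app a (F y))"
        by (simp add: app_linear algebra_simps)
      then show "x + y + app a (F x + F y) = F x + F y"
        by (simp only: F)
    qed
    show "F (c *\<^sub>C x) = c *\<^sub>C F x" for c x
      by (rule F_eq) (use F[of x] in \<open>simp add: app_linear scaleC_add_right[symmetric]\<close>)
    show "norm (F x) \<le> (1 / (1 - norm a)) * norm x" for x
    proof -
      have "norm (F x) \<le> norm x + norm a * norm (F x)"
        using norm_triangle_ineq[of x "app a (F x)"] norm_app[of a "F x"] F[of x] by simp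
      then show ?thesis
        using assms by (simp add: field_simps)
    qed
  qed
  then have "(1 - a) * Cop F = 1" "Cop F * (1 - a) = 1"
    using F by (auto intro!: cop_eqI F_eq simp: app_Cop) (metis add_diff_cancel_right')
  then show ?thesis
    by (auto simp: unit_op_def)
qed

text \<open>Factoring \<open>z = a * (1 - b * (a - z))\<close> gives an explicit radius, the
  reciprocal of \<open>norm b\<close>, for the openness of the invertible operators.\<close>

lemma unit_op_perturb:
  fixes a :: "'a::complex_banach cop"
  assumes "a * b = 1" "b * a = 1" "norm (a - z) * norm b < 1"
  shows "unit_op z"
proof -
  have "norm (b * (a - z)) < 1"
    using norm_mult_ineq[of b "a - z"] assms(3) by (simp add: mult.commute)
  then have "unit_op (1 - b * (a - z))"
    by (rule unit_op_one_minus)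
  moreover have "z = a * (1 - b * (a - z))"
    using assms(1) by (simp add: right_diff_distrib flip: mult.assoc)
  moreover have "unit_op a"
    using assms by (auto simp: unit_op_def)
  ultimately show ?thesis
    by (metis unit_op_mult)
qed

lemma compact_Spec:
  fixes a :: "'a::complex_banach cop"
  shows "compact (Spec UNIV (app a))"
proof -
  have "Spec UNIV (app a) \<subseteq> cball 0 (norm a)"
  proof
    fix z assume z: "z \<in> Spec UNIV (app a)"
    show "z \<in> cball 0 (norm a)"
    proof (rule ccontr)
      assume "z \<notin> cball 0 (norm a)"
      then have n: "norm a < cmod z" by simp
      then have "norm ((1 / z) *\<^sub>C a) < 1" "z \<noteq> 0"
        using norm_ge_zero[of a] by (auto simp: norm_scaleC norm_divide divide_less_eq simp del: norm_ge_zero)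
      then have "unit_op (z *\<^sub>C (1 - (1 / z) *\<^sub>C a))"
        by (intro unit_op_scaleC unit_op_one_minus)
      then show False
        using z \<open>z \<noteq> 0\<close> by (simp add: Spec_UNIV_iff scaleC_algebra)
    qed
  qed
  moreover have "open (- Spec UNIV (app a))"
    unfolding open_dist
  proof
    fix z assume "z \<in> - Spec UNIV (app a)"
    then obtain b where b: "(z *\<^sub>C 1 - a) * b = 1" "b * (z *\<^sub>C 1 - a) = 1"
      by (auto simp: Spec_UNIV_iff unit_op_def)
    \<comment> \<open>The \<open>+ 1\<close> keeps the radius positive when \<open>b = 0\<close>,
      which happens over the zero space.\<close>
    have "w \<in> - Spec UNIV (app a)" if "dist w z < 1 / (norm b + 1)" for w
    proof -
      have "norm (z *\<^sub>C 1 - a - (w *\<^sub>C 1 - a)) = cmod (z - w) * norm (1::'a cop)"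
        by (simp add: scaleC_diff_left[symmetric] norm_scaleC)
      also have "\<dots> \<le> dist w z"
        using norm_cop_one_le[where 'a = 'a] by (simp add: dist_norm norm_minus_commute mult_left_le)
      finally have "norm (z *\<^sub>C 1 - a - (w *\<^sub>C 1 - a)) * norm b \<le> dist w z * norm b"
        by (rule mult_right_mono) simp
      also have "\<dots> \<le> dist w z * (norm b + 1)"
        by (intro mult_left_mono) auto
      also have "\<dots> < 1"
        using that pos_less_divide_eq[of "norm b + 1" "dist w z" 1] by (simp add: add_nonneg_pos)
      finally show ?thesis
        using unit_op_perturb[OF b] by (simp add: Spec_UNIV_iff)
    qed
    then show "\<exists>e>0. \<forall>w. dist w z < e \<longrightarrow> w \<in> - Spec UNIV (app a)"
      by (intro exI[of _ "1 / (norm b + 1)"]) (auto simp: add_nonneg_pos)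
  qed
  ultimately show ?thesis
    by (meson compact_eq_bounded_closed bounded_cball bounded_subset closed_def)
qed

section \<open>Perturbation by a commuting operator\<close>

text \<open>\<open>U z\<close> is the inverse of \<open>1 - z S\<close>, the resolvent in the
  inverted variable. Such a \<open>U\<close> exists exactly when the spectrum of \<open>S\<close>
  lies in the open unit disc; off the closed disc its values are arbitrary.\<close>

definition disc_resolvent :: "'a::complex_banach cop \<Rightarrow> (complex \<Rightarrow> 'a cop) \<Rightarrow> bool" where
  "disc_resolvent S U \<longleftrightarrow>
    (\<forall>z. cmod z \<le> 1 \<longrightarrow> (1 - z *\<^sub>C S) * U z = 1 \<and> U z * (1 - z *\<^sub>C S) = 1)"

text \<open>The resolvent identity \<open>U y - U x = (y - x) *\<^sub>C (U y * (S * U x))\<close>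
  gives continuity once \<open>norm (U y)\<close> on its right side is bounded in terms of
  \<open>norm (U x)\<close>.\<close>

lemma disc_resolvent_continuous:
  assumes U: "disc_resolvent S U"
  shows "continuous_on (cball 0 1) U"
  unfolding continuous_on_iff
proof (intro ballI allI impI)
  fix x :: complex and e :: real
  assume x: "x \<in> cball 0 1" and e: "0 < e"
  define C where "C = norm S * norm (U x)"
  have C: "0 \<le> C" by (simp add: C_def)
  \<comment> \<open>The first entry forces \<open>norm (U y) \<le> 2 * norm (U x)\<close>; with that
    the second brings the difference below \<open>e\<close>.\<close>
  define d where "d = min (1 / (2 * (C + 1))) (e / (2 * norm (U x) * C + 1))"
  have d: "0 < d"
    using e C by (auto simp: d_def add_nonneg_pos)
  have "dist (U y) (U x) < e" if y: "y \<in> cball 0 1" and yx: "dist y x < d" for y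
  proof -
    have "U y - U x = U y * ((1 - x *\<^sub>C S) * U x) - (U y * (1 - y *\<^sub>C S)) * U x"
      using U x y by (simp add: disc_resolvent_def)
    also have "\<dots> = (y - x) *\<^sub>C (U y * (S * U x))"
      by (simp add: algebra_simps scaleC_algebra)
    finally have "norm (U y - U x) = dist y x * norm (U y * (S * U x))"
      by (simp add: norm_scaleC dist_norm)
    also have "\<dots> \<le> dist y x * (norm (U y) * C)"
      unfolding C_def
      by (intro mult_left_mono order_trans[OF norm_mult_ineq]) (auto intro: norm_mult_ineq)
    finally have *: "norm (U y - U x) \<le> dist y x * C * norm (U y)"
      by (simp add: mult_ac)
    have "dist y x * C \<le> d * (C + 1)"
      using yx d C by (intro mult_mono) auto
    also have "\<dots> \<le> 1 / 2"
    proof -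
      have "d * (C + 1) \<le> (1 / (2 * (C + 1))) * (C + 1)"
        using C by (intro mult_right_mono) (auto simp: d_def)
      also have "\<dots> = 1 / 2" using C by (simp add: field_simps add_nonneg_eq_0_iff)
      finally show ?thesis .
    qed
    finally have "dist y x * C * norm (U y) \<le> 1 / 2 * norm (U y)"
      by (rule mult_right_mono) simp
    with * have "norm (U y - U x) \<le> 1 / 2 * norm (U y)" by simp
    moreover have "norm (U y) \<le> norm (U x) + norm (U y - U x)"
      by (rule norm_triangle_sub)
    ultimately have "norm (U y) \<le> 2 * norm (U x)" by simp
    then have "dist y x * C * norm (U y) \<le> dist y x * C * (2 * norm (U x))"
      using C by (intro mult_left_mono) auto
    with * have "norm (U y - U x) \<le> dist y x * (2 * norm (U x) * C)"
      by (simp add: mult_ac)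
    also have "\<dots> \<le> dist y x * (2 * norm (U x) * C + 1)"
      by (intro mult_left_mono) auto
    also have "\<dots> < e"
    proof -
      have "dist y x < e / (2 * norm (U x) * C + 1)"
        using yx by (simp add: d_def)
      then show ?thesis
        using C by (subst (asm) pos_less_divide_eq) (auto intro!: add_nonneg_pos)
    qed
    finally show ?thesis by (simp add: dist_norm)
  qed
  with d show "\<exists>d>0. \<forall>x'\<in>cball 0 1. dist x' x < d \<longrightarrow> dist (U x') (U x) < e"
    by blast
qed

text \<open>Rickart's averaging argument with square roots in place of general roots of unity: the
  inverse of \<open>1 - w\<^sup>2 S\<^sup>2\<close> is the mean of those of \<open>1 - w S\<close> and \<open>1 + w S\<close>, so that estimates
  which are uniform on the disc survive squaring.\<close>

lemma disc_resolvent_square: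
  assumes U: "disc_resolvent S U"
    and e: "\<And>z. cmod z \<le> 1 \<Longrightarrow> norm (U (complex_of_real s * z) - U (complex_of_real r * z)) \<le> e"
  obtains V where "disc_resolvent (S * S) V"
    and "\<And>z. cmod z \<le> 1 \<Longrightarrow>
      norm (V (complex_of_real (s\<^sup>2) * z) - V (complex_of_real (r\<^sup>2) * z)) \<le> e"
proof -
  \<comment> \<open>The mean is symmetric in the two roots, so the branch cut of
    \<open>csqrt\<close> leaves no trace and \<open>V (w\<^sup>2)\<close> can be computed from
    either root.\<close>
  define V where "V z = (1 / 2) *\<^sub>C (U (csqrt z) + U (- csqrt z))" for z
  have V_square: "V (w\<^sup>2) = (1 / 2) *\<^sub>C (U w + U (- w))" for w
  proof -
    have "csqrt (w\<^sup>2) = w \<or> csqrt (w\<^sup>2) = - w"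
      by (metis power2_csqrt power2_eq_iff)
    then show ?thesis by (auto simp: V_def add.commute)
  qed
  have "disc_resolvent (S * S) V"
    unfolding disc_resolvent_def
  proof (intro allI impI)
    fix z :: complex assume z: "cmod z \<le> 1"
    define w where "w = csqrt z"
    have w: "cmod w \<le> 1" "z = w * w"
      using z by (auto simp: w_def norm_csqrt simp flip: power2_eq_square)
    define P Q where "P = 1 - w *\<^sub>C S" and "Q = 1 + w *\<^sub>C S"
    have PQ: "1 - z *\<^sub>C (S * S) = P * Q" "1 - z *\<^sub>C (S * S) = Q * P" "P + Q = 2 *\<^sub>C 1"
      using scaleC_add_left[of 1 1 "1 :: 'a cop"]
      by (simp_all add: P_def Q_def w algebra_simps scaleC_algebra)
    have "P * U w = 1" "U w * P = 1" "Q * U (- w) = 1" "U (- w) * Q = 1"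
      using U[unfolded disc_resolvent_def, rule_format, of w]
        U[unfolded disc_resolvent_def, rule_format, of "- w"] w(1)
      by (simp_all add: P_def Q_def)
    then have "Q * P * U w + P * Q * U (- w) = 2 *\<^sub>C 1" "U w * (P * Q) + U (- w) * (Q * P) = 2 *\<^sub>C 1"
      using PQ(3) by (simp_all add: mult.assoc) (simp_all add: add.commute flip: mult.assoc)
    then have "(1 - z *\<^sub>C (S * S)) * (U w + U (- w)) = 2 *\<^sub>C 1"
      "(U w + U (- w)) * (1 - z *\<^sub>C (S * S)) = 2 *\<^sub>C 1"
      by (metis PQ(1,2) distrib_left distrib_right)+
    then show "(1 - z *\<^sub>C (S * S)) * V z = 1 \<and> V z * (1 - z *\<^sub>C (S * S)) = 1"
      by (simp add: V_def w_def[symmetric] scaleC_scaleC)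
  qed
  moreover have "norm (V (complex_of_real (s\<^sup>2) * z) - V (complex_of_real (r\<^sup>2) * z)) \<le> e"
    if z: "cmod z \<le> 1" for z
  proof -
    define w where "w = csqrt z"
    have w: "cmod w \<le> 1" "z = w\<^sup>2"
      using z by (auto simp: w_def norm_csqrt)
    have "V (complex_of_real (s\<^sup>2) * z) - V (complex_of_real (r\<^sup>2) * z)
      = V ((complex_of_real s * w)\<^sup>2) - V ((complex_of_real r * w)\<^sup>2)"
      by (simp add: w power_mult_distrib)
    also have "\<dots> = (1 / 2) *\<^sub>C ((U (complex_of_real s * w) - U (complex_of_real r * w)) +
        (U (complex_of_real s * - w) - U (complex_of_real r * - w)))"
      unfolding V_square by (simp add: scaleC_algebra)
    finally have "norm (V (complex_of_real (s\<^sup>2) * z) - V (complex_of_real (r\<^sup>2) * z))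
      = 1 / 2 * norm ((U (complex_of_real s * w) - U (complex_of_real r * w)) +
        (U (complex_of_real s * - w) - U (complex_of_real r * - w)))"
      by (simp add: norm_scaleC)
    also have "\<dots> \<le> 1 / 2 * (e + e)"
      using e[of w] e[of "- w"] w by (intro mult_left_mono norm_triangle_le add_mono) auto
    finally show ?thesis by simp
  qed
  ultimately show thesis by (rule that)
qed

lemma power_two_power_Suc: "(a::'a::monoid_mult) ^ 2 ^ Suc n = a ^ 2 ^ n * a ^ 2 ^ n"
  by (simp add: mult_2 power_add)

lemma disc_resolvent_power:
  assumes "disc_resolvent S U"
    and "\<And>z. cmod z \<le> 1 \<Longrightarrow> norm (U (complex_of_real s * z) - U (complex_of_real r * z)) \<le> e"
  shows "\<exists>V. disc_resolvent (S ^ 2 ^ n) V \<and> (\<forall>z. cmod z \<le> 1 \<longrightarrow>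
      norm (V (complex_of_real (s ^ 2 ^ n) * z) - V (complex_of_real (r ^ 2 ^ n) * z)) \<le> e)"
proof (induction n)
  case 0
  then show ?case using assms by auto
next
  case (Suc n)
  then obtain V where "disc_resolvent (S ^ 2 ^ n) V" "\<And>z. cmod z \<le> 1 \<Longrightarrow>
      norm (V (complex_of_real (s ^ 2 ^ n) * z) - V (complex_of_real (r ^ 2 ^ n) * z)) \<le> e"
    by blast
  from disc_resolvent_square[OF this] show ?case
    unfolding power_two_power_Suc by (metis power2_eq_square)
qed

text \<open>By submultiplicativity each term is at most the square of its predecessor, so a single
  term below 1 forces the sequence to 0.\<close>

lemma power_two_power_small:
  fixes S :: "'a::complex_banach cop"
  assumes "r ^ 2 ^ m * norm (S ^ 2 ^ m) < 1" "0 \<le> r" "0 < e"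
  shows "\<exists>n. r ^ 2 ^ n * norm (S ^ 2 ^ n) < e"
proof -
  define q where "q = r ^ 2 ^ m * norm (S ^ 2 ^ m)"
  have q: "0 \<le> q" "q < 1" using assms by (auto simp: q_def)
  have le: "r ^ 2 ^ (m + k) * norm (S ^ 2 ^ (m + k)) \<le> q ^ 2 ^ k" for k
  proof (induction k)
    case (Suc k)
    have "r ^ 2 ^ (m + Suc k) * norm (S ^ 2 ^ (m + Suc k))
      \<le> (r ^ 2 ^ (m + k) * norm (S ^ 2 ^ (m + k))) * (r ^ 2 ^ (m + k) * norm (S ^ 2 ^ (m + k)))"
      using norm_mult_ineq[of "S ^ 2 ^ (m + k)" "S ^ 2 ^ (m + k)"] assms(2)
      unfolding add_Suc_right power_two_power_Suc
      by (simp add: mult_ac mult_left_mono)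
    also have "\<dots> \<le> q ^ 2 ^ k * q ^ 2 ^ k"
      using Suc assms(2) q by (intro mult_mono) auto
    finally show ?case
      unfolding power_two_power_Suc .
  qed (simp add: q_def)
  obtain k where "q ^ k < e"
    using real_arch_pow_inv[OF assms(3) q(2)] by auto
  moreover have "q ^ 2 ^ k \<le> q ^ k"
    using q by (intro power_decreasing) auto
  ultimately show ?thesis
    using le[of k] by (intro exI[of _ "m + k"]) simp
qed

text \<open>Smallness is carried from radius \<open>r\<close> to radius \<open>s\<close>. For large
  \<open>n\<close> the operator \<open>a\<close> at \<open>r\<close> is tiny, so its resolvent value
  \<open>A\<close> is near 1. Since the bound on the variation of the resolvent does not deteriorate
  with \<open>n\<close>, the value \<open>B\<close> at \<open>s\<close> is near 1 as well, and this
  makes \<open>b\<close> small.\<close>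

lemma disc_resolvent_continuation:
  assumes U: "disc_resolvent S U"
    and e: "\<And>z. cmod z \<le> 1 \<Longrightarrow> norm (U (complex_of_real s * z) - U (complex_of_real r * z)) \<le> 1 / 8"
    and r: "0 \<le> r" "r \<le> 1" "0 \<le> s" "s \<le> 1"
    and m: "r ^ 2 ^ m * norm (S ^ 2 ^ m) < 1"
  shows "\<exists>n. s ^ 2 ^ n * norm (S ^ 2 ^ n) < 1"
proof -
  \<comment> \<open>The margin \<open>1 / 16\<close> puts \<open>A\<close> within 1/8 of 1, the
    variation 1/8 puts \<open>B\<close> within 1/4 of 1, and
    \<open>b = (B - 1) - (B - 1) * b\<close> then has norm at most 1/3.\<close>
  obtain n where n: "r ^ 2 ^ n * norm (S ^ 2 ^ n) < 1 / 16"
    using power_two_power_small[OF m r(1), of "1 / 16"] by auto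
  obtain V where V: "disc_resolvent (S ^ 2 ^ n) V" and Ve: "\<And>z. cmod z \<le> 1 \<Longrightarrow>
      norm (V (complex_of_real (s ^ 2 ^ n) * z) - V (complex_of_real (r ^ 2 ^ n) * z)) \<le> 1 / 8"
    using disc_resolvent_power[OF U e, where n = n] by auto
  define a b A B where "a = complex_of_real (r ^ 2 ^ n) *\<^sub>C S ^ 2 ^ n"
    and "b = complex_of_real (s ^ 2 ^ n) *\<^sub>C S ^ 2 ^ n"
    and "A = V (complex_of_real (r ^ 2 ^ n))" and "B = V (complex_of_real (s ^ 2 ^ n))"
  have na: "norm a < 1 / 16" and nb: "norm b = s ^ 2 ^ n * norm (S ^ 2 ^ n)"
    using n r by (simp_all add: a_def b_def norm_scaleC norm_power)
  have "A * (1 - a) = 1" "B * (1 - b) = 1"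
    using V r by (auto simp: disc_resolvent_def a_def b_def A_def B_def norm_power power_le_one)
  then have A: "A - 1 = (A - 1) * a + a" and B: "b = (B - 1) - (B - 1) * b"
    by (simp_all add: algebra_simps)
  have AB: "norm (B - A) \<le> 1 / 8"
    using Ve[of 1] by (simp add: A_def B_def)
  have "norm (A - 1) \<le> norm (A - 1) * norm a + norm a"
    using A norm_triangle_ineq[of "(A - 1) * a" a] norm_mult_ineq[of "A - 1" a] by simp
  also have "\<dots> \<le> norm (A - 1) * (1 / 16) + 1 / 16"
    using na by (intro add_mono mult_left_mono) auto
  finally have "norm (A - 1) \<le> 1 / 8" by simp
  then have "norm (B - 1) \<le> 1 / 4"
    using AB norm_triangle_ineq[of "B - A" "A - 1"] by simp
  then have "norm (B - 1) * norm b \<le> 1 / 4 * norm b"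
    by (intro mult_right_mono) auto
  moreover have "norm b \<le> norm (B - 1) + norm (B - 1) * norm b"
    using B norm_triangle_ineq4[of "B - 1" "(B - 1) * b"] norm_mult_ineq[of "B - 1" b] by simp
  ultimately have "norm b < 1"
    using \<open>norm (B - 1) \<le> 1 / 4\<close> by simp
  then show ?thesis using nb by auto
qed

text \<open>This is the spectral radius statement that spectrum in the open unit disc makes some
  power a strict contraction. Radius 0 is trivial; radius 1 is reached in \<open>N\<close> steps, so
  short that by uniform continuity \<open>U\<close> varies by less than 1/8 in each.\<close>

lemma power_small_if_disc_resolvent:
  assumes U: "disc_resolvent S U"
  shows "\<exists>n. norm (S ^ 2 ^ n) < 1"
proof -
  have "uniformly_continuous_on (cball 0 1) U"
    using disc_resolvent_continuous[OF U] by (rule compact_uniformly_continuous) simp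
  then obtain d where d: "0 < d" "\<And>x y. x \<in> cball 0 1 \<Longrightarrow> y \<in> cball 0 1 \<Longrightarrow> dist y x < d \<Longrightarrow>
      dist (U y) (U x) < 1 / 8"
    unfolding uniformly_continuous_on_def by (metis zero_less_divide_1_iff zero_less_numeral)
  obtain N :: nat where N: "0 < N" "1 / real N < d"
    using d(1) by (metis nat_approx_posE zero_less_Suc)
  have "\<exists>n. (real k / real N) ^ 2 ^ n * norm (S ^ 2 ^ n) < 1" if "k \<le> N" for k
    using that
  proof (induction k)
    case 0
    show ?case by (auto simp: power_0_left)
  next
    case (Suc k)
    then obtain m where m: "(real k / real N) ^ 2 ^ m * norm (S ^ 2 ^ m) < 1" by auto
    show ?case
    proof (rule disc_resolvent_continuation[OF U _ _ _ _ _ m])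
      fix z :: complex assume z: "cmod z \<le> 1"
      let ?s = "complex_of_real (real (Suc k) / real N) * z" and ?r = "complex_of_real (real k / real N) * z"
      have "?s - ?r = complex_of_real (1 / real N) * z"
        using N by (simp add: field_simps)
      then have "dist ?s ?r = 1 / real N * cmod z"
        by (simp add: dist_norm norm_mult del: of_real_divide of_real_1)
      also have "\<dots> \<le> 1 / real N"
        using z N by (simp add: divide_right_mono)
      finally have d': "dist ?s ?r < d" using N by simp
      have ball: "complex_of_real t * z \<in> cball 0 1" if "0 \<le> t" "t \<le> 1" for t
        using that z by (simp add: norm_mult mult_le_one)
      moreover have "?s \<in> cball 0 1" "?r \<in> cball 0 1"
        using ball[of "real (Suc k) / real N"] ball[of "real k / real N"] Suc.prems N by simp_all
      ultimately show "norm (U ?s - U ?r) \<le> 1 / 8"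
        using d(2)[of ?r ?s] d' unfolding dist_norm by linarith
    qed (use N Suc.prems in auto)
  qed
  from this[of N] N show ?thesis by simp
qed

text \<open>\<open>1 - b * b\<close> is the product of the commuting factors \<open>1 - b\<close>
  and \<open>1 + b\<close>, so one squaring is undone at a time.\<close>

lemma unit_op_one_minus_power:
  assumes "unit_op (1 - a ^ 2 ^ n)"
  shows "unit_op (1 - a)"
  using assms
proof (induction n)
  case (Suc n)
  let ?b = "a ^ 2 ^ n"
  have "(1 - ?b) * (1 + ?b) = 1 - ?b * ?b" "(1 + ?b) * (1 - ?b) = 1 - ?b * ?b"
    by (simp_all add: algebra_simps)
  with Suc show ?case
    unfolding power_two_power_Suc using unit_op_factor[of "1 - ?b" "1 + ?b"] by auto
qed simp

lemma power_mult_commuting: "(a::'a::monoid_mult) * b = b * a \<Longrightarrow> (a * b) ^ n = a ^ n * b ^ n"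
proof (induction n)
  case (Suc n)
  have "b * a ^ n = a ^ n * b"
    using power_commuting_commutes[of a b n] Suc.prems by simp
  have "(a * b) ^ Suc n = a * (b * a ^ n) * b ^ n"
    unfolding power_Suc Suc.IH[OF Suc.prems] by (simp only: mult.assoc)
  also have "\<dots> = a ^ Suc n * b ^ Suc n"
    by (simp add: \<open>b * a ^ n = a ^ n * b\<close> mult.assoc)
  finally show ?case .
qed simp

lemma norm_cop_power_le: "norm ((a::'a::complex_normed_vector cop) ^ n) \<le> norm a ^ n"
proof (induction n)
  case (Suc n)
  then show ?case
    using norm_mult_ineq[of a "a ^ n"] mult_left_mono[OF Suc, of "norm a"] by simp
qed (simp add: norm_cop_one_le)

lemma cop_scaleC_power: "(c *\<^sub>C (a::'a::complex_normed_vector cop)) ^ n = c ^ n *\<^sub>C a ^ n"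
  by (induction n) (auto simp: scaleC_scaleC mult.commute)

text \<open>Invertibility on the whole disc bounds the spectral radius of \<open>S\<close>, the
  inverse of \<open>\<mu> *\<^sub>C 1 - Y\<close>, so
  \<open>d ^ 2 ^ n * norm (S ^ 2 ^ n) < 1\<close> for some \<open>n\<close>. As
  \<open>E = X - Y\<close> commutes with \<open>S\<close>, powers of \<open>S * E\<close> split, and
  the powers of \<open>E\<close> are absorbed by those of \<open>d\<close>.\<close>

lemma unit_op_commuting_perturb:
  fixes X Y :: "'a::complex_banach cop"
  assumes comm: "X * Y = Y * X" and d: "norm (X - Y) < d"
    and unit: "\<And>z. cmod (z - \<mu>) \<le> d \<Longrightarrow> unit_op (z *\<^sub>C 1 - Y)"
  shows "unit_op (\<mu> *\<^sub>C 1 - X)"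
proof -
  have d0: "0 < d" using d norm_ge_zero[of "X - Y"] by linarith
  define M E where "M = \<mu> *\<^sub>C 1 - Y" and "E = X - Y"
  have M: "unit_op M"
    using unit[of \<mu>] d0 by (simp add: M_def)
  then obtain S where S: "M * S = 1" "S * M = 1"
    by (auto simp: unit_op_def)
  then have S': "unit_op S"
    by (auto simp: unit_op_def)
  have ME: "M * E = E * M"
    by (simp add: M_def E_def left_diff_distrib right_diff_distrib scaleC_diff_right comm)
  have SE: "S * E = E * S"
    by (metis S ME mult.assoc mult_1_left mult_1_right)
  \<comment> \<open>Scaling by \<open>d\<close> turns the disc about \<open>\<mu>\<close> into the
    unit disc: \<open>1 - z *\<^sub>C T\<close> is \<open>S\<close> times
    \<open>(\<mu> - z * d) *\<^sub>C 1 - Y\<close>.\<close>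
  define T where "T = complex_of_real d *\<^sub>C S"
  have "unit_op (1 - z *\<^sub>C T)" if "cmod z \<le> 1" for z
  proof -
    have "cmod ((\<mu> - z * d) - \<mu>) \<le> d"
      using that d0 by (simp add: norm_mult mult_left_le_one_le)
    then have "unit_op (S * ((\<mu> - z * d) *\<^sub>C 1 - Y))"
      by (intro unit_op_mult S' unit)
    moreover have "S * ((\<mu> - z * d) *\<^sub>C 1 - Y) = S * M - z *\<^sub>C T"
      by (simp add: M_def T_def algebra_simps scaleC_algebra)
    ultimately show ?thesis by (simp add: S)
  qed
  then have "\<exists>U. disc_resolvent T U"
    unfolding disc_resolvent_def unit_op_def by metis
  then obtain n where "norm (T ^ 2 ^ n) < 1"
    using power_small_if_disc_resolvent by blast
  then have n: "d ^ 2 ^ n * norm (S ^ 2 ^ n) < 1"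
    using d0 by (simp add: T_def cop_scaleC_power norm_scaleC norm_power)
  have "norm ((S * E) ^ 2 ^ n) \<le> norm (S ^ 2 ^ n) * norm (E ^ 2 ^ n)"
    unfolding power_mult_commuting[OF SE] by (rule norm_mult_ineq)
  also have "\<dots> \<le> norm (S ^ 2 ^ n) * d ^ 2 ^ n"
    using d by (intro mult_left_mono order_trans[OF norm_cop_power_le] power_mono) (auto simp: E_def)
  finally have "norm ((S * E) ^ 2 ^ n) < 1"
    using n by (simp add: mult.commute)
  then have "unit_op (1 - S * E)"
    by (rule unit_op_one_minus_power[OF unit_op_one_minus])
  moreover have "M * (1 - S * E) = M - E"
    using S(1) by (simp add: right_diff_distrib flip: mult.assoc)
  moreover have "\<mu> *\<^sub>C 1 - X = M - E"
    by (simp add: M_def E_def)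
  ultimately show ?thesis
    using unit_op_mult[OF M, of "1 - S * E"] by simp
qed

lemma Spec_limit:
  fixes X :: "'a::complex_banach cop" and g :: "complex \<Rightarrow> complex"
  assumes K: "compact K" and g: "continuous_on K g"
    and approx: "\<And>e. 0 < e \<Longrightarrow> \<exists>Y h. Spec UNIV (app Y) = h ` K \<and> X * Y = Y * X \<and>
      norm (X - Y) < e \<and> (\<forall>w\<in>K. cmod (h w - g w) < e)"
  shows "Spec UNIV (app X) = g ` K"
proof (intro equalityI subsetI)
  fix \<mu> assume \<mu>: "\<mu> \<in> Spec UNIV (app X)"
  show "\<mu> \<in> g ` K"
  proof (rule ccontr)
    assume "\<mu> \<notin> g ` K"
    moreover have "closed (g ` K)"
      by (intro compact_imp_closed compact_continuous_image g K)
    ultimately obtain d where d: "0 < d" "\<And>w. w \<in> K \<Longrightarrow> d \<le> dist \<mu> (g w)"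
      using separate_point_closed[of "g ` K" \<mu>] by auto
    obtain Y h where Y: "Spec UNIV (app Y) = h ` K" "X * Y = Y * X" "norm (X - Y) < d / 2"
      and h: "\<And>w. w \<in> K \<Longrightarrow> cmod (h w - g w) < d / 2"
      using approx[of "d / 2"] d(1) by auto
    have "unit_op (\<mu> *\<^sub>C 1 - X)"
    proof (rule unit_op_commuting_perturb[OF Y(2,3)])
      fix z assume z: "cmod (z - \<mu>) \<le> d / 2"
      have "z \<notin> h ` K"
      proof
        assume "z \<in> h ` K"
        then obtain w where w: "w \<in> K" "z = h w" by auto
        have "dist \<mu> (g w) \<le> cmod (z - \<mu>) + cmod (h w - g w)"
          using dist_triangle[of \<mu> "g w" z] by (simp add: w dist_norm norm_minus_commute)
        with z h[OF w(1)] d(2)[OF w(1)] show False by simp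
      qed
      then show "unit_op (z *\<^sub>C 1 - Y)"
        using Y(1) Spec_UNIV_iff by blast
    qed
    with \<mu> show False by (simp add: Spec_UNIV_iff)
  qed
next
  fix \<mu> assume "\<mu> \<in> g ` K"
  then obtain w where w: "w \<in> K" "\<mu> = g w" by auto
  show "\<mu> \<in> Spec UNIV (app X)"
    unfolding Spec_UNIV_iff
  proof
    assume "unit_op (\<mu> *\<^sub>C 1 - X)"
    then obtain b where b: "(\<mu> *\<^sub>C 1 - X) * b = 1" "b * (\<mu> *\<^sub>C 1 - X) = 1"
      by (auto simp: unit_op_def)
    \<comment> \<open>The factor 2 pays for two errors, that of \<open>h w\<close> against
      \<open>g w\<close> and that of \<open>Y\<close> against \<open>X\<close>.\<close>
    define e where "e = 1 / (2 * (norm b + 1))"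
    have e: "0 < e" by (simp add: e_def add_nonneg_pos)
    obtain Y h where Y: "Spec UNIV (app Y) = h ` K" "norm (X - Y) < e"
      and h: "\<And>w. w \<in> K \<Longrightarrow> cmod (h w - g w) < e"
      using approx[OF e] by auto
    have "norm (\<mu> *\<^sub>C 1 - X - (h w *\<^sub>C 1 - Y)) = norm ((g w - h w) *\<^sub>C 1 - (X - Y))"
      by (simp add: w scaleC_algebra algebra_simps)
    also have "\<dots> \<le> cmod (g w - h w) * norm (1::'a cop) + norm (X - Y)"
      using norm_triangle_ineq4 by (metis norm_scaleC)
    also have "\<dots> \<le> cmod (g w - h w) * 1 + norm (X - Y)"
      using norm_cop_one_le by (intro add_mono mult_left_mono) auto
    also have "\<dots> \<le> 2 * e"
      using h[OF w(1)] Y(2) by (simp add: norm_minus_commute)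
    finally have "norm (\<mu> *\<^sub>C 1 - X - (h w *\<^sub>C 1 - Y)) * norm b \<le> 2 * e * norm b"
      by (rule mult_right_mono) simp
    also have "\<dots> < 1"
      by (simp add: e_def divide_less_eq add_nonneg_pos)
    finally have "unit_op (h w *\<^sub>C 1 - Y)"
      by (rule unit_op_perturb[OF b])
    then have "h w \<notin> h ` K"
      using Y(1) Spec_UNIV_iff by blast
    with w(1) show False by blast
  qed
qed

section \<open>Rational functions of an operator\<close>

text \<open>Horner's scheme for p(R): the coefficients are complex while the values lie in a
  noncommutative algebra, so \<open>poly\<close> does not apply.\<close>

definition peval :: "complex poly \<Rightarrow> 'a::complex_normed_vector cop \<Rightarrow> 'a cop" where
  "peval p R = fold_coeffs (\<lambda>a b. a *\<^sub>C 1 + R * b) p 0"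

lemma peval_0 [simp]: "peval 0 R = 0"
  by (simp add: peval_def)

lemma peval_pCons [simp]: "peval (pCons a p) R = a *\<^sub>C 1 + R * peval p R"
  by (cases "p = 0 \<and> a = 0") (auto simp: peval_def)

lemma peval_add: "peval (p + q) R = peval p R + peval q R"
  by (induction p q rule: poly_induct2) (auto simp: scaleC_algebra algebra_simps)

lemma peval_smult: "peval (smult c p) R = c *\<^sub>C peval p R"
  by (induction p) (auto simp: scaleC_algebra)

lemma peval_diff: "peval (p - q) R = peval p R - peval q R"
  using peval_add[of p "smult (- 1) q" R] by (simp only: peval_smult) simp

lemma peval_mult: "peval (p * q) R = peval p R * peval q R"
  by (induction p) (auto simp: peval_add peval_smult algebra_simps mult.assoc)

lemma unit_op_peval:
  fixes R :: "'a::complex_normed_vector cop"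
  assumes "p \<noteq> 0" "\<And>w. poly p w = 0 \<Longrightarrow> w \<notin> Spec UNIV (app R)"
  shows "unit_op (peval p R)"
  using assms
proof (induction "degree p" arbitrary: p)
  case 0
  then obtain c where "p = [:c:]" "c \<noteq> 0"
    by (metis degree_eq_zeroE pCons_0_0)
  moreover have "unit_op (1 :: 'a cop)"
    by (auto simp: unit_op_def)
  ultimately show ?case
    using unit_op_scaleC by simp
next
  case (Suc n)
  then obtain w where w: "poly p w = 0"
    using fundamental_theorem_of_algebra[of p] constant_degree[of p] by auto
  then obtain q where q: "p = [:- w, 1:] * q"
    by (metis dvdE poly_eq_0_iff_dvd)
  with Suc have "q \<noteq> 0" by auto
  then have "degree p = Suc (degree q)"
    unfolding q by (subst degree_mult_eq) auto
  with Suc q \<open>q \<noteq> 0\<close> have "unit_op (peval q R)" by auto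
  moreover have "unit_op (peval [:- w, 1:] R)"
    using unit_op_scaleC[of "- 1" "w *\<^sub>C 1 - R"] Suc.prems(2)[OF w] by (simp add: Spec_UNIV_iff)
  ultimately show ?case
    by (simp only: q peval_mult unit_op_mult)
qed

text \<open>A root \<open>w\<close> of \<open>p\<close> splits off \<open>R - w\<close> as a
  commuting factor of p(R), which is invertible if p(R) is. Nonemptiness of the spectrum excludes
  \<open>p = 0\<close> in the converse; later the point 0 provides it.\<close>

lemma unit_op_peval_iff:
  fixes R :: "'a::complex_normed_vector cop"
  assumes ne: "Spec UNIV (app R) \<noteq> {}"
  shows "unit_op (peval p R) \<longleftrightarrow> (\<forall>w\<in>Spec UNIV (app R). poly p w \<noteq> 0)"
proof (intro iffI ballI notI)
  fix w assume u: "unit_op (peval p R)" and w: "w \<in> Spec UNIV (app R)" and 0: "poly p w = 0"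
  obtain q where q: "p = [:- w, 1:] * q"
    using 0 by (metis dvdE poly_eq_0_iff_dvd)
  have "peval p R = peval [:- w, 1:] R * peval q R" "peval p R = peval q R * peval [:- w, 1:] R"
    unfolding q by (simp_all only: peval_mult[symmetric] mult.commute)
  then have "unit_op (peval [:- w, 1:] R)"
    using u unit_op_factor by metis
  then show False
    using w unit_op_scaleC[of "- 1" "peval [:- w, 1:] R"] by (simp add: Spec_UNIV_iff)
next
  assume "\<forall>w\<in>Spec UNIV (app R). poly p w \<noteq> 0"
  moreover from this have "p \<noteq> 0" using ne by auto
  ultimately show "unit_op (peval p R)"
    by (intro unit_op_peval) auto
qed

text \<open>The equation for \<open>Y\<close> encodes p(R) divided by q(R). Multiplying
  \<open>\<mu> *\<^sub>C 1 - Y\<close> by the invertible q(R) turns it into the polynomial \<mu> q -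
  p at \<open>R\<close>, whose invertibility is decided by its roots.\<close>

lemma Spec_rational:
  assumes ne: "Spec UNIV (app R) \<noteq> {}"
    and q: "\<And>w. w \<in> Spec UNIV (app R) \<Longrightarrow> poly q w \<noteq> 0"
    and Y: "Y * peval q R = peval p R"
  shows "Spec UNIV (app Y) = (\<lambda>w. poly p w / poly q w) ` Spec UNIV (app R)"
proof (rule set_eqI)
  fix \<mu>
  have Q: "unit_op (peval q R)"
    using q unit_op_peval_iff[OF ne] by blast
  then obtain b where b: "peval q R * b = 1" "b * peval q R = 1"
    by (auto simp: unit_op_def)
  have *: "(\<mu> *\<^sub>C 1 - Y) * peval q R = peval (smult \<mu> q - p) R"
    by (simp add: peval_diff peval_smult left_diff_distrib Y)
  then have **: "\<mu> *\<^sub>C 1 - Y = peval (smult \<mu> q - p) R * b"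
    by (metis b(1) mult.assoc mult_1_right)
  have "unit_op b" using b by (auto simp: unit_op_def)
  then have "unit_op (\<mu> *\<^sub>C 1 - Y) \<longleftrightarrow> unit_op (peval (smult \<mu> q - p) R)"
    using * ** Q by (metis unit_op_mult)
  also have "\<dots> \<longleftrightarrow> (\<forall>w\<in>Spec UNIV (app R). \<mu> * poly q w \<noteq> poly p w)"
    unfolding unit_op_peval_iff[OF ne] by simp
  also have "\<dots> \<longleftrightarrow> \<mu> \<notin> (\<lambda>w. poly p w / poly q w) ` Spec UNIV (app R)"
    using q by (auto simp: image_iff eq_divide_eq)
  finally show "\<mu> \<in> Spec UNIV (app Y) \<longleftrightarrow> \<mu> \<in> (\<lambda>w. poly p w / poly q w) ` Spec UNIV (app R)"
    by (simp add: Spec_UNIV_iff)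
qed

text \<open>Below, \<open>content\<close> is the volume of a box in a tagged sum.\<close>

hide_const (open) Polynomial.content

section \<open>Approximation in the mean\<close>

text \<open>A tagged sum of \<open>F\<close> differs from that of \<open>G\<close> by at most the
  tagged sum of \<open>h\<close>, which on a fine division is close to the small integral of
  \<open>h\<close>. The Cauchy criterion then applies in every Banach space.\<close>

lemma integrable_L1_limit_cbox:
  fixes F :: "'n::euclidean_space \<Rightarrow> 'a::banach"
  assumes approx: "\<And>e. 0 < e \<Longrightarrow> \<exists>G h. G integrable_on cbox a b \<and> h integrable_on cbox a b \<and>
      (\<forall>x\<in>cbox a b. norm (F x - G x) \<le> h x) \<and> integral (cbox a b) h < e"
  shows "F integrable_on cbox a b"
  unfolding integrable_Cauchy
proof (intro allI impI)
  fix e :: real assume "0 < e"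
  \<comment> \<open>Three errors of \<open>e / 8\<close> arise per division: the integral of
    \<open>h\<close>, its tagged sum, and the tagged sum of \<open>G\<close>. Two divisions make six
    eighths.\<close>
  then have e: "0 < e / 8" by simp
  obtain G h where G: "G integrable_on cbox a b" and h: "h integrable_on cbox a b"
    and le: "\<And>x. x \<in> cbox a b \<Longrightarrow> norm (F x - G x) \<le> h x" and small: "integral (cbox a b) h < e / 8"
    using approx[OF e] by blast
  obtain \<gamma> where \<gamma>: "gauge \<gamma>" "\<And>\<D>. \<D> tagged_division_of cbox a b \<Longrightarrow> \<gamma> fine \<D> \<Longrightarrow>
      norm ((\<Sum>(x,k)\<in>\<D>. content k *\<^sub>R G x) - integral (cbox a b) G) < e / 8"
    using has_integralD[OF integrable_integral[OF G] e] by blast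
  obtain \<delta> where \<delta>: "gauge \<delta>" "\<And>\<D>. \<D> tagged_division_of cbox a b \<Longrightarrow> \<delta> fine \<D> \<Longrightarrow>
      norm ((\<Sum>(x,k)\<in>\<D>. content k *\<^sub>R h x) - integral (cbox a b) h) < e / 8"
    using has_integralD[OF integrable_integral[OF h] e] by blast
  have near: "norm ((\<Sum>(x,k)\<in>\<D>. content k *\<^sub>R F x) - integral (cbox a b) G) < 3 * (e / 8)"
    if \<D>: "\<D> tagged_division_of cbox a b" "(\<lambda>x. \<gamma> x \<inter> \<delta> x) fine \<D>" for \<D>
  proof -
    have fine: "\<gamma> fine \<D>" "\<delta> fine \<D>" using \<D>(2) by (auto simp: fine_Int)
    have "norm ((\<Sum>(x,k)\<in>\<D>. content k *\<^sub>R F x) - (\<Sum>(x,k)\<in>\<D>. content k *\<^sub>R G x))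
      = norm (\<Sum>(x,k)\<in>\<D>. content k *\<^sub>R (F x - G x))"
      by (simp add: sum_subtractf[symmetric] case_prod_unfold scaleR_diff_right)
    also have "\<dots> \<le> (\<Sum>(x,k)\<in>\<D>. content k *\<^sub>R h x)"
    proof (rule sum_norm_le)
      fix p assume p: "p \<in> \<D>"
      obtain x k where xk: "p = (x, k)" by fastforce
      have "x \<in> cbox a b" using tagged_division_ofD(2,3)[OF \<D>(1)] p xk by blast
      from le[OF this] show "norm (case p of (x, k) \<Rightarrow> content k *\<^sub>R (F x - G x)) \<le> (case p of (x, k) \<Rightarrow> content k *\<^sub>R h x)"
        by (simp add: xk mult_left_mono)
    qed
    finally have "norm ((\<Sum>(x,k)\<in>\<D>. content k *\<^sub>R F x) - (\<Sum>(x,k)\<in>\<D>. content k *\<^sub>R G x)) < 2 * (e / 8)"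
      using \<delta>(2)[OF \<D>(1) fine(2)] small by (simp add: abs_if split: if_splits)
    then show ?thesis
      using \<gamma>(2)[OF \<D>(1) fine(1)]
        norm_triangle_ineq[of "(\<Sum>(x,k)\<in>\<D>. content k *\<^sub>R F x) - (\<Sum>(x,k)\<in>\<D>. content k *\<^sub>R G x)"
          "(\<Sum>(x,k)\<in>\<D>. content k *\<^sub>R G x) - integral (cbox a b) G"] by simp
  qed
  have close: "norm (x - y) < e" if "norm (x - z) < 3 * (e / 8)" "norm (y - z) < 3 * (e / 8)" for x y z :: 'a
    using that norm_triangle_ineq4[of "x - z" "y - z"] \<open>0 < e\<close> by simp
  show "\<exists>\<gamma>. gauge \<gamma> \<and> (\<forall>\<D>1 \<D>2. \<D>1 tagged_division_of cbox a b \<and> \<gamma> fine \<D>1 \<and>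
      \<D>2 tagged_division_of cbox a b \<and> \<gamma> fine \<D>2 \<longrightarrow>
      norm ((\<Sum>(x, K)\<in>\<D>1. content K *\<^sub>R F x) - (\<Sum>(x, K)\<in>\<D>2. content K *\<^sub>R F x)) < e)"
  proof (intro exI[of _ "\<lambda>x. \<gamma> x \<inter> \<delta> x"] conjI allI impI)
    show "gauge (\<lambda>x. \<gamma> x \<inter> \<delta> x)"
      using \<gamma>(1) \<delta>(1) by (rule gauge_Int)
    fix \<D>1 \<D>2 assume "\<D>1 tagged_division_of cbox a b \<and> (\<lambda>x. \<gamma> x \<inter> \<delta> x) fine \<D>1 \<and>
      \<D>2 tagged_division_of cbox a b \<and> (\<lambda>x. \<gamma> x \<inter> \<delta> x) fine \<D>2"
    then show "norm ((\<Sum>(x, K)\<in>\<D>1. content K *\<^sub>R F x) - (\<Sum>(x, K)\<in>\<D>2. content K *\<^sub>R F x)) < e"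
      using close[OF near near] by simp
  qed
qed

text \<open>Boxes are settled by the previous lemma. The Cauchy condition for growing boxes is
  inherited from \<open>G\<close>: since the zero extension of \<open>h\<close> is nonnegative, one
  number bounds the error over all boxes at once.\<close>

lemma integrable_L1_limit:
  fixes F :: "'n::euclidean_space \<Rightarrow> 'a::banach"
  assumes approx: "\<And>e. 0 < e \<Longrightarrow> \<exists>G h. G integrable_on S \<and> h integrable_on S \<and>
      (\<forall>x\<in>S. norm (F x - G x) \<le> h x) \<and> integral S h < e"
  shows "F integrable_on S"
proof -
  define F' where "F' x = (if x \<in> S then F x else 0)" for x
  have approx': "\<exists>G h. G integrable_on UNIV \<and> h integrable_on UNIV \<and>
      (\<forall>x. norm (F' x - G x) \<le> h x) \<and> (\<forall>a b. integral (cbox a b) h < e)"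
    if e: "0 < e" for e
  proof -
    obtain G h where G: "G integrable_on S" and h: "h integrable_on S"
      and le: "\<And>x. x \<in> S \<Longrightarrow> norm (F x - G x) \<le> h x" and small: "integral S h < e"
      using approx[OF e] by blast
    define G' h' where "G' x = (if x \<in> S then G x else 0)" and "h' x = (if x \<in> S then h x else 0)" for x
    have nonneg: "0 \<le> h' x" for x
      using order_trans[OF norm_ge_zero le[of x]] by (simp add: h'_def)
    have G': "G' integrable_on UNIV" and h': "h' integrable_on UNIV"
      unfolding G'_def h'_def using G h by (simp_all add: integrable_restrict_UNIV)
    have "integral (cbox a b) h' < e" for a b
    proof -
      have "integral (cbox a b) h' \<le> integral UNIV h'"
        using h' nonneg by (intro integral_subset_le integrable_on_subcbox) auto
      also have "\<dots> = integral S h" unfolding h'_def by (rule integral_restrict_UNIV)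
      finally show ?thesis using small by simp
    qed
    moreover have "norm (F' x - G' x) \<le> h' x" for x
      using le by (simp add: F'_def G'_def h'_def)
    ultimately show ?thesis
      using G' h' by (intro exI[of _ G'] exI[of _ h']) simp
  qed
  have sub: "g integrable_on cbox a b" if "g integrable_on UNIV" for g :: "'n \<Rightarrow> 'b::banach" and a b
    using that by (rule integrable_on_subcbox) simp
  have F': "F' integrable_on cbox a b" for a b
  proof (rule integrable_L1_limit_cbox)
    fix e :: real assume "0 < e"
    from approx'[OF this] obtain G h where *: "G integrable_on UNIV" "h integrable_on UNIV"
      "\<And>x. norm (F' x - G x) \<le> h x" "\<And>a b. integral (cbox a b) h < e"
      by auto
    then show "\<exists>G h. G integrable_on cbox a b \<and> h integrable_on cbox a b \<and>
        (\<forall>x\<in>cbox a b. norm (F' x - G x) \<le> h x) \<and> integral (cbox a b) h < e"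
      by (intro exI[of _ G] exI[of _ h]) (simp add: sub)
  qed
  show ?thesis
    unfolding integrable_alt[of F] F'_def[symmetric]
  proof (intro conjI allI impI F')
    fix e :: real assume "0 < e"
    then have e: "0 < e / 4" by simp
    from approx'[OF this] obtain G h where G: "G integrable_on UNIV" and h: "h integrable_on UNIV"
      and le: "\<And>x. norm (F' x - G x) \<le> h x" and small: "\<And>a b. integral (cbox a b) h < e / 4"
      by auto
    obtain B where B: "B > 0" "\<And>a b c d. ball 0 B \<subseteq> cbox a b \<and> ball 0 B \<subseteq> cbox c d \<Longrightarrow>
        norm (integral (cbox a b) G - integral (cbox c d) G) < e / 4"
      using integrable_altD(2)[OF G e] by auto
    have near: "norm (integral (cbox a b) F' - integral (cbox a b) G) < e / 4" for a b
    proof -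
      have "norm (integral (cbox a b) (\<lambda>x. F' x - G x)) \<le> integral (cbox a b) h"
        using le by (intro integral_norm_bound_integral integrable_diff F' sub G h)
      then show ?thesis
        using small[of a b] by (simp add: integral_diff F' sub G)
    qed
    have close: "norm (x - y) < e" if "norm (x - u) < e / 4" "norm (y - v) < e / 4" "norm (u - v) < e / 4"
      for x y u v :: 'a
      using that norm_triangle_ineq[of "x - u" "u - v"] norm_triangle_ineq4[of "x - v" "y - v"] \<open>0 < e\<close>
      by simp
    show "\<exists>B>0. \<forall>a b c d. ball 0 B \<subseteq> cbox a b \<and> ball 0 B \<subseteq> cbox c d \<longrightarrow>
        norm (integral (cbox a b) F' - integral (cbox c d) F') < e"
      using close[OF near near B(2)] B(1) by (intro exI[of _ B] conjI allI impI)
  qed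
qed

lemma L1_dominated_convergence:
  fixes f :: "nat \<Rightarrow> 'n::euclidean_space \<Rightarrow> 'm::euclidean_space"
  assumes f: "\<And>k. f k \<in> borel_measurable (lebesgue_on S)" and S: "S \<in> sets lebesgue"
    and h: "h integrable_on S" and le: "\<And>k x. x \<in> S \<Longrightarrow> norm (f k x) \<le> h x"
    and N: "negligible N" and lim: "\<And>x. x \<in> S \<Longrightarrow> x \<notin> N \<Longrightarrow> (\<lambda>k. f k x) \<longlonglongrightarrow> 0"
  shows "(\<lambda>x. norm (f k x)) integrable_on S" "(\<lambda>k. integral S (\<lambda>x. norm (f k x))) \<longlonglongrightarrow> 0"
proof -
  show int: "(\<lambda>x. norm (f k x)) integrable_on S" for k
    using measurable_bounded_by_integrable_imp_absolutely_integrable[OF f S h le]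
    by (auto simp: absolutely_integrable_on_def)
  \<comment> \<open>Resetting the values on \<open>N\<close> gives convergence everywhere and leaves
    the integrals unchanged.\<close>
  define g where "g k x = (if x \<in> N then 0 else norm (f k x))" for k x
  have gint: "g k integrable_on S" for k
    by (rule integrable_spike[OF int N]) (simp add: g_def)
  have "(\<lambda>k. integral S (g k)) \<longlonglongrightarrow> integral S (\<lambda>x. 0 :: real)"
  proof (rule dominated_convergence(2)[OF gint h])
    show "norm (g k x) \<le> h x" if "x \<in> S" for k x
      using le[OF that, of k] norm_ge_zero[of "f k x"] unfolding g_def by (auto simp del: norm_ge_zero)
    show "(\<lambda>k. g k x) \<longlonglongrightarrow> 0" if "x \<in> S" for x
      using lim[OF that] by (cases "x \<in> N") (auto simp: g_def intro: tendsto_norm_zero)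
  qed
  moreover have "integral S (g k) = integral S (\<lambda>x. norm (f k x))" for k
    by (rule integral_spike[OF N]) (simp add: g_def)
  ultimately show "(\<lambda>k. integral S (\<lambda>x. norm (f k x))) \<longlonglongrightarrow> 0" by simp
qed

text \<open>For \<open>0 < r\<close> this is the radial retraction of the plane onto the closed disc
  of radius \<open>r\<close>; the form with \<open>max\<close> is visibly continuous in both
  arguments.\<close>

definition clip :: "real \<Rightarrow> complex \<Rightarrow> complex" where
  "clip r z = complex_of_real (r / max r (cmod z)) * z"

lemma norm_clip_le: "0 < r \<Longrightarrow> cmod (clip r z) \<le> r"
  by (auto simp: clip_def norm_mult norm_divide max_def divide_le_eq)

lemma norm_diff_clip_le:
  assumes "0 < r"
  shows "cmod (z - clip r z) \<le> cmod z"
proof -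
  have "z - clip r z = complex_of_real (1 - r / max r (cmod z)) * z"
    by (simp add: clip_def algebra_simps)
  moreover have "\<bar>1 - r / max r (cmod z)\<bar> \<le> 1"
    using assms by (auto simp: max_def divide_le_eq)
  ultimately show ?thesis
    by (metis mult_left_le_one_le norm_ge_zero abs_ge_zero norm_mult norm_of_real)
qed

lemma clip_eq: "0 < r \<Longrightarrow> cmod z \<le> r \<Longrightarrow> clip r z = z"
  by (simp add: clip_def max_def)

lemma continuous_on_clip [continuous_intros]:
  assumes "continuous_on S r" "continuous_on S g" "\<And>x. x \<in> S \<Longrightarrow> 0 < r x"
  shows "continuous_on S (\<lambda>x. clip (r x) (g x))"
proof -
  have "max (r x) (cmod (g x)) \<noteq> 0" if "x \<in> S" for x
    using assms(3)[OF that] by (auto simp: max_def)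
  then show ?thesis
    unfolding clip_def using assms by (intro continuous_intros) auto
qed

lemma integrable_exp_minus_Ioi: "(\<lambda>t::real. exp (- t)) integrable_on {0<..}"
  and integral_exp_minus_Ioi: "integral {0<..} (\<lambda>t::real. exp (- t)) = 1"
proof -
  have "((\<lambda>t::real. exp (- t)) has_integral 1) {0..}"
    using has_integral_exp_minus_to_infinity[of 1 0] by simp
  then have "((\<lambda>t::real. exp (- t)) has_integral 1) {0<..}"
    by (subst has_integral_spike_set_eq[where T = "{0..}"]) (auto intro: negligible_subset[of "{0}"])
  then show "(\<lambda>t::real. exp (- t)) integrable_on {0<..}" "integral {0<..} (\<lambda>t::real. exp (- t)) = 1"
    by (auto simp: integrable_on_def)
qed

lemma integral_norm_diff_less_add:
  fixes f g h :: "real \<Rightarrow> complex"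
  assumes "(\<lambda>t. cmod (f t - g t)) integrable_on S" "(\<lambda>t. cmod (g t - h t)) integrable_on S"
    and "(\<lambda>t. cmod (f t - h t)) integrable_on S"
    and "integral S (\<lambda>t. cmod (f t - g t)) < a" "integral S (\<lambda>t. cmod (g t - h t)) < b"
  shows "integral S (\<lambda>t. cmod (f t - h t)) < a + b"
proof -
  have "integral S (\<lambda>t. cmod (f t - h t)) \<le> integral S (\<lambda>t. cmod (f t - g t) + cmod (g t - h t))"
  proof (intro integral_le integrable_add assms)
    show "cmod (f t - h t) \<le> cmod (f t - g t) + cmod (g t - h t)" for t
      using norm_triangle_ineq[of "f t - g t" "g t - h t"] by simp
  qed
  also have "\<dots> < a + b"
    using assms by (simp add: integral_add)
  finally show ?thesis .
qed

text \<open>Clipping \<open>f\<close> to a multiple of \<open>exp (- t)\<close> costs little and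
  provides an integrable majorant \<open>r\<close> for the second stage. There measurability yields
  continuous functions converging almost everywhere to \<open>f\<close>; clipped to \<open>r\<close>
  they converge dominatedly to the clipped \<open>f\<close>.\<close>

lemma L1_approx_continuous:
  fixes f :: "real \<Rightarrow> complex"
  assumes f: "f absolutely_integrable_on {0<..}" and e: "0 < e"
  obtains H b where "continuous_on UNIV H" "\<And>t. b \<le> t \<Longrightarrow> H t = 0"
    "H absolutely_integrable_on {0<..}" "integral {0<..} (\<lambda>t. cmod (f t - H t)) < e"
proof -
  define S where "S = {0::real<..}"
  have S: "S \<in> sets lebesgue" by (simp add: S_def)
  have fm: "f \<in> borel_measurable (lebesgue_on S)"
    using f S absolutely_integrable_imp_borel_measurable S_def by blast
  have em: "(\<lambda>t::real. exp (- t)) \<in> borel_measurable (lebesgue_on S)"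
    using S by (intro continuous_imp_measurable_on_sets_lebesgue continuous_intros)
  have fn: "(\<lambda>t. cmod (f t)) integrable_on S"
    using f by (simp add: S_def absolutely_integrable_on_def)
  have clipm: "(\<lambda>t. clip (a * exp (- t)) (f t)) \<in> borel_measurable (lebesgue_on S)" for a
    unfolding clip_def using fm em by measurable
  define F where "F n t = clip (real (Suc n) * exp (- t)) (f t)" for n t
  have "(\<lambda>n. integral S (\<lambda>t. cmod (f t - F n t))) \<longlonglongrightarrow> 0"
  proof (rule L1_dominated_convergence(2)[OF _ S fn])
    show "(\<lambda>t. f t - F n t) \<in> borel_measurable (lebesgue_on S)" for n
      unfolding F_def using clipm fm by (intro borel_measurable_diff)
    show "cmod (f t - F n t) \<le> cmod (f t)" for n t
      unfolding F_def by (intro norm_diff_clip_le) simp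
    show "(\<lambda>n. f t - F n t) \<longlonglongrightarrow> 0" for t
    proof (rule tendsto_eventually)
      obtain m where m: "cmod (f t) * exp t \<le> real m" using real_arch_simple by blast
      have "f t - F n t = 0" if "m \<le> n" for n
      proof -
        have "cmod (f t) * exp t \<le> real (Suc n)" using m that by simp
        then have "cmod (f t) * exp t * exp (- t) \<le> real (Suc n) * exp (- t)"
          by (rule mult_right_mono) simp
        moreover have "cmod (f t) * exp t * exp (- t) = cmod (f t)"
          by (simp add: mult.assoc flip: exp_add)
        ultimately show ?thesis by (simp add: F_def clip_eq)
      qed
      then show "\<forall>\<^sub>F n in sequentially. f t - F n t = 0"
        by (auto simp: eventually_sequentially)
    qed
  qed auto
  then obtain m where m: "integral S (\<lambda>t. cmod (f t - F m t)) < e / 2"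
    using e by (metis (no_types, lifting) half_gt_zero order_tendstoD(2) eventually_sequentially order_refl)
  define r where "r t = real (Suc m) * exp (- t)" for t
  have r0: "0 < r t" for t by (simp add: r_def)
  have rint: "r integrable_on S"
    unfolding r_def S_def by (intro integrable_on_mult_right integrable_exp_minus_Ioi)
  have "f measurable_on S"
    using measurable_on_iff_borel_measurable[OF S] fm by blast
  then obtain N g where N: "negligible N" and g: "\<And>n. continuous_on UNIV (g n)"
    and glim: "\<And>t. t \<notin> N \<Longrightarrow> (\<lambda>n. g n t) \<longlonglongrightarrow> (if t \<in> S then f t else 0)"
    unfolding measurable_on_def by blast
  \<comment> \<open>The first factor is a continuous cutoff: 1 up to \<open>n - 1\<close>, and 0
    from \<open>n\<close> on.\<close>
  define H where "H n t = complex_of_real (max 0 (min 1 (real n - t))) * clip (r t) (g n t)" for n t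
  have H: "continuous_on UNIV (H n)" for n
    unfolding H_def r_def by (intro continuous_intros g) auto
  have Hm: "H n \<in> borel_measurable (lebesgue_on S)" for n
    using S H by (intro continuous_imp_measurable_on_sets_lebesgue) (auto intro: continuous_on_subset)
  have Hle: "cmod (H n t) \<le> r t" for n t
  proof -
    have "cmod (H n t) = \<bar>max 0 (min 1 (real n - t))\<bar> * cmod (clip (r t) (g n t))"
      by (simp add: H_def norm_mult)
    also have "\<dots> \<le> 1 * r t"
      using r0[of t] by (intro mult_mono norm_clip_le) auto
    finally show ?thesis by simp
  qed
  have Habs: "H n absolutely_integrable_on S" for n
    by (rule measurable_bounded_by_integrable_imp_absolutely_integrable[OF Hm S rint Hle])
  have "(\<lambda>n. integral S (\<lambda>t. cmod (F m t - H n t))) \<longlonglongrightarrow> 0"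
  proof (rule L1_dominated_convergence(2)[OF _ S _ _ N])
    show "(\<lambda>t. F m t - H n t) \<in> borel_measurable (lebesgue_on S)" for n
      unfolding F_def using clipm Hm by (intro borel_measurable_diff)
    show "(\<lambda>t. r t + r t) integrable_on S"
      using rint by (intro integrable_add)
    have "cmod (F m t) \<le> r t" for t
      unfolding F_def r_def by (intro norm_clip_le) simp
    then show "cmod (F m t - H n t) \<le> r t + r t" for n t
      using Hle norm_triangle_ineq4[of "F m t" "H n t"] by (meson add_mono order_trans)
    fix t assume t: "t \<in> S" "t \<notin> N"
    have "(\<lambda>n. clip (r t) (g n t)) \<longlonglongrightarrow> clip (r t) (f t)"
      unfolding clip_def using glim[of t] t r0[of t] by (intro tendsto_intros) (auto simp: max_def)
    moreover have "(\<lambda>n. complex_of_real (max 0 (min 1 (real n - t)))) \<longlonglongrightarrow> 1"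
    proof (rule tendsto_eventually)
      obtain k where "t + 1 \<le> real k" using real_arch_simple by blast
      then show "\<forall>\<^sub>F n in sequentially. complex_of_real (max 0 (min 1 (real n - t))) = 1"
        unfolding eventually_sequentially by (intro exI[of _ k]) (auto simp: max_def min_def)
    qed
    ultimately have "(\<lambda>n. H n t) \<longlonglongrightarrow> 1 * clip (r t) (f t)"
      unfolding H_def by (rule tendsto_mult[rotated])
    then show "(\<lambda>n. F m t - H n t) \<longlonglongrightarrow> 0"
      by (intro tendsto_eq_intros) (auto simp: F_def r_def)
  qed
  then obtain n where n: "integral S (\<lambda>t. cmod (F m t - H n t)) < e / 2"
    using e by (metis (no_types, lifting) half_gt_zero order_tendstoD(2) eventually_sequentially order_refl)
  have Fabs: "F m absolutely_integrable_on S"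
    by (rule measurable_bounded_by_integrable_imp_absolutely_integrable[OF _ S rint])
      (auto simp: F_def[abs_def] r_def intro!: clipm norm_clip_le simp del: of_nat_Suc)
  have diff: "(\<lambda>t. cmod (u t - v t)) integrable_on S"
    if "u absolutely_integrable_on S" "v absolutely_integrable_on S" for u v :: "real \<Rightarrow> complex"
    using set_integral_diff(1)[OF that] by (simp add: absolutely_integrable_on_def)
  have "integral S (\<lambda>t. cmod (f t - H n t)) < e / 2 + e / 2"
    by (rule integral_norm_diff_less_add[OF _ _ _ m n]; rule diff; use f Fabs Habs in \<open>simp add: S_def\<close>)
  then show thesis
    using that[of "H n" "real n"] H Habs by (auto simp: S_def H_def)
qed

lemma real_polynomial_function_complex_poly:
  assumes "real_polynomial_function (q :: real \<Rightarrow> real)"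
  shows "\<exists>p. \<forall>s. complex_of_real (q s) = poly p (complex_of_real s)"
  using assms
proof induction
  case (linear q)
  have "q s = s * q 1" for s
    using linear_simps(5)[OF linear, of s 1] by simp
  then show ?case
    by (intro exI[of _ "[:0, complex_of_real (q 1):]"]) (metis mult.commute of_real_mult poly_pCons poly_0 add_0 mult_zero_right add_0_right)
next
  case (const c)
  then show ?case by (intro exI[of _ "[:complex_of_real c:]"]) simp
next
  case (add q1 q2)
  then show ?case by (metis of_real_add poly_add)
next
  case (mult q1 q2)
  then show ?case by (metis of_real_mult poly_mult)
qed

lemma complex_poly_approx:
  fixes u :: "real \<Rightarrow> complex"
  assumes "compact S" "continuous_on S u" "0 < e"
  obtains p where "\<And>s. s \<in> S \<Longrightarrow> cmod (u s - poly p (complex_of_real s)) < e"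
proof -
  obtain q1 where q1: "real_polynomial_function q1" "\<And>s. s \<in> S \<Longrightarrow> \<bar>Re (u s) - q1 s\<bar> < e / 2"
    using Stone_Weierstrass_real_polynomial_function[of S "\<lambda>s. Re (u s)" "e / 2"] assms
    by (auto intro: continuous_intros)
  obtain q2 where q2: "real_polynomial_function q2" "\<And>s. s \<in> S \<Longrightarrow> \<bar>Im (u s) - q2 s\<bar> < e / 2"
    using Stone_Weierstrass_real_polynomial_function[of S "\<lambda>s. Im (u s)" "e / 2"] assms
    by (auto intro: continuous_intros)
  obtain p1 p2 where p: "\<And>s. complex_of_real (q1 s) = poly p1 (complex_of_real s)"
    "\<And>s. complex_of_real (q2 s) = poly p2 (complex_of_real s)"
    using q1 q2 real_polynomial_function_complex_poly by metis
  have "cmod (u s - poly (p1 + smult \<i> p2) (complex_of_real s)) < e" if "s \<in> S" for s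
  proof -
    have "Re (u s - poly (p1 + smult \<i> p2) (complex_of_real s)) = Re (u s) - q1 s"
      "Im (u s - poly (p1 + smult \<i> p2) (complex_of_real s)) = Im (u s) - q2 s"
      by (simp_all flip: p)
    then show ?thesis
      using cmod_le[of "u s - poly (p1 + smult \<i> p2) (complex_of_real s)"] q1(2)[OF that] q2(2)[OF that]
      by linarith
  qed
  then show thesis by (rule that)
qed

text \<open>In the variable s = exp (- t) one approximates \<open>u\<close>, which is
  \<open>H\<close> divided by s, rather than \<open>H\<close>. Multiplying the polynomial by s
  afterwards makes the uniform error integrable in \<open>t\<close> and raises every exponent to at
  least 1.\<close>

lemma L1_approx_exp:
  fixes f :: "real \<Rightarrow> complex"
  assumes f: "f absolutely_integrable_on {0<..}" and e: "0 < e"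
  obtains c n where "(\<lambda>t. \<Sum>k<n. c k * exp (- (of_nat (Suc k) * complex_of_real t))) absolutely_integrable_on {0<..}"
    and "integral {0<..} (\<lambda>t. cmod (f t - (\<Sum>k<n. c k * exp (- (of_nat (Suc k) * complex_of_real t))))) < e"
proof -
  obtain H b where H: "continuous_on UNIV H" "\<And>t. b \<le> t \<Longrightarrow> H t = 0"
    "H absolutely_integrable_on {0<..}" and fH: "integral {0<..} (\<lambda>t. cmod (f t - H t)) < e / 2"
    using L1_approx_continuous[OF f, of "e / 2"] e by auto
  define \<delta> where "\<delta> = exp (- b)"
  have \<delta>: "0 < \<delta>" "ln \<delta> = - b" by (simp_all add: \<delta>_def)
  \<comment> \<open>For \<open>s \<le> \<delta>\<close> the numerator is \<open>H b = 0\<close>, so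
    \<open>u\<close> vanishes near 0 and the division does no harm.\<close>
  define u where "u s = H (- ln (max s \<delta>)) / complex_of_real (max s \<delta>)" for s
  have "0 < max s \<delta>" for s using \<delta> by (simp add: less_max_iff_disj)
  then have pos: "max s \<delta> \<noteq> 0" for s by (metis less_irrefl)
  have u: "continuous_on UNIV u"
    unfolding u_def
    by (intro continuous_intros continuous_on_compose2[OF H(1)]) (use pos in auto)
  have uH: "complex_of_real (exp (- t)) * u (exp (- t)) = H t" for t
  proof (cases "b \<le> t")
    case True
    then have "max (exp (- t)) \<delta> = \<delta>" by (simp add: \<delta>_def max_def)
    then show ?thesis using True H(2) by (simp add: u_def \<delta>)
  next
    case False
    then have "max (exp (- t)) \<delta> = exp (- t)" by (simp add: \<delta>_def max_def)
    then show ?thesis by (simp add: u_def)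
  qed
  obtain p where p: "\<And>s. s \<in> {0..1} \<Longrightarrow> cmod (u s - poly p (complex_of_real s)) < e / 4"
    using complex_poly_approx[of "{0..1}" u "e / 4"] continuous_on_subset[OF u, of "{0..1}"] e
    by (metis compact_Icc divide_pos_pos subset_UNIV zero_less_numeral)
  define P where "P t = complex_of_real (exp (- t)) * poly p (complex_of_real (exp (- t)))" for t
  have PH: "cmod (H t - P t) \<le> (e / 4) * exp (- t)" if "0 < t" for t
  proof -
    have "H t - P t = complex_of_real (exp (- t)) * (u (exp (- t)) - poly p (complex_of_real (exp (- t))))"
      by (simp add: right_diff_distrib uH) (simp add: P_def)
    then have "cmod (H t - P t) = exp (- t) * cmod (u (exp (- t)) - poly p (complex_of_real (exp (- t))))"
      by (simp add: norm_mult)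
    also have "\<dots> \<le> exp (- t) * (e / 4)"
      using p[of "exp (- t)"] that by (intro mult_left_mono) auto
    finally show ?thesis by (simp add: mult.commute)
  qed
  have Pc: "continuous_on {0<..} P"
    unfolding P_def by (intro continuous_intros)
  have rint: "(\<lambda>t. (e / 4) * exp (- t)) integrable_on {0<..}"
    by (intro integrable_on_mult_right integrable_exp_minus_Ioi)
  have "(\<lambda>t. H t - P t) absolutely_integrable_on {0<..}"
  proof (rule measurable_bounded_by_integrable_imp_absolutely_integrable[OF _ _ rint])
    show "(\<lambda>t. H t - P t) \<in> borel_measurable (lebesgue_on {0<..})"
      using H(1) Pc by (intro continuous_imp_measurable_on_sets_lebesgue continuous_on_diff)
        (auto intro: continuous_on_subset)
  qed (use PH in auto)
  from set_integral_diff(1)[OF H(3) this] have P: "P absolutely_integrable_on {0<..}" by simp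
  have diff: "(\<lambda>t. cmod (u t - v t)) integrable_on {0<..}"
    if "u absolutely_integrable_on {0<..}" "v absolutely_integrable_on {0<..}" for u v :: "real \<Rightarrow> complex"
    using set_integral_diff(1)[OF that] by (simp add: absolutely_integrable_on_def)
  have "integral {0<..} (\<lambda>t. cmod (H t - P t)) \<le> integral {0<..} (\<lambda>t. (e / 4) * exp (- t))"
    using PH by (intro integral_le diff H(3) P rint) auto
  also have "\<dots> = e / 4" by (simp add: integral_exp_minus_Ioi)
  also have "\<dots> < e / 2" using e by simp
  finally have "integral {0<..} (\<lambda>t. cmod (f t - P t)) < e / 2 + e / 2"
    by (intro integral_norm_diff_less_add[OF _ _ _ fH] diff f H(3) P)
  moreover have "P = (\<lambda>t. \<Sum>k<Suc (degree p). coeff p k * exp (- (of_nat (Suc k) * complex_of_real t)))"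
  proof
    fix t
    have "complex_of_real (exp (- t)) * (complex_of_real (exp (- t))) ^ k
      = exp (- (of_nat (Suc k) * complex_of_real t))" for k
    proof -
      have "complex_of_real (exp (- t)) = exp (- complex_of_real t)"
        by (metis exp_of_real of_real_minus)
      then show ?thesis
        by (metis exp_of_nat_mult mult_minus_right power_Suc)
    qed
    then show "P t = (\<Sum>k<Suc (degree p). coeff p k * exp (- (of_nat (Suc k) * complex_of_real t)))"
      unfolding P_def poly_altdef sum_distrib_left lessThan_Suc_atMost
      by (intro sum.cong) (auto simp: mult.left_commute)
  qed
  ultimately show thesis
    using that[where c = "coeff p" and n = "Suc (degree p)"] P by auto
qed

section \<open>Integrals along a bounded semigroup\<close>

lemma has_integral_shift_UNIV:
  fixes g :: "real \<Rightarrow> 'a::banach"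
  assumes "(g has_integral I) UNIV"
  shows "((\<lambda>t. g (t + c)) has_integral I) UNIV"
  unfolding has_integral'[of _ _ UNIV]
proof (intro allI impI)
  fix e :: real assume "0 < e"
  then obtain B where B: "0 < B" "\<And>a b. ball 0 B \<subseteq> cbox a b \<Longrightarrow>
      \<exists>z. ((\<lambda>t. if t \<in> UNIV then g t else 0) has_integral z) (cbox a b) \<and> norm (z - I) < e"
    using assms unfolding has_integral'[of g] by meson
  have "\<exists>z. ((\<lambda>t. if t \<in> UNIV then g (t + c) else 0) has_integral z) (cbox a b) \<and> norm (z - I) < e"
    if ab: "ball 0 (B + \<bar>c\<bar>) \<subseteq> cbox a b" for a b
  proof -
    have "ball 0 B \<subseteq> cbox (a + c) (b + c)"
    proof
      fix t assume "t \<in> ball (0::real) B"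
      then have "t - c \<in> ball 0 (B + \<bar>c\<bar>)" by (auto simp: dist_norm)
      with ab have "t - c \<in> cbox a b" by blast
      then show "t \<in> cbox (a + c) (b + c)" by auto
    qed
    from B(2)[OF this] obtain z where z: "(g has_integral z) (cbox (a + c) (b + c))" "norm (z - I) < e"
      by auto
    from has_integral_shift_cbox[OF z(1), of c] z(2) show ?thesis by auto
  qed
  then show "\<exists>B>0. \<forall>a b. ball 0 B \<subseteq> cbox a b \<longrightarrow>
      (\<exists>z. ((\<lambda>t. if t \<in> UNIV then g (t + c) else 0) has_integral z) (cbox a b) \<and> norm (z - I) < e)"
    using B(1) by (intro exI[of _ "B + \<bar>c\<bar>"]) auto
qed

lemma has_vector_derivative_quotient:
  fixes F :: "real \<Rightarrow> 'a::real_normed_vector"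
  assumes "(F has_vector_derivative D) (at 0 within {0..1})"
  shows "((\<lambda>h. (F h - F 0) /\<^sub>R h) \<longlongrightarrow> D) (at_right 0)"
proof -
  have "((\<lambda>h. norm (F h - F 0 - (h - 0) *\<^sub>R D) / norm (h - 0)) \<longlongrightarrow> 0) (at_right 0)"
    using assms unfolding has_vector_derivative_def has_derivative_iff_norm
    by (simp add: at_within_Icc_at_right)
  moreover have "\<forall>\<^sub>F h in at_right 0. norm (F h - F 0 - (h - 0) *\<^sub>R D) / norm (h - 0)
      = norm ((F h - F 0) /\<^sub>R h - D)"
    unfolding eventually_at_right_field
  proof (intro exI[of _ 1] conjI allI impI)
    fix h :: real assume h: "0 < h"
    then have "(F h - F 0) /\<^sub>R h - D = (1 / h) *\<^sub>R (F h - F 0 - h *\<^sub>R D)"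
      by (simp add: scaleR_diff_right divide_inverse)
    then show "norm (F h - F 0 - (h - 0) *\<^sub>R D) / norm (h - 0) = norm ((F h - F 0) /\<^sub>R h - D)"
      using h by simp
  qed simp
  ultimately have "((\<lambda>h. norm ((F h - F 0) /\<^sub>R h - D)) \<longlongrightarrow> 0) (at_right 0)"
    by (rule Lim_transform_eventually)
  then show ?thesis
    using LIM_zero_cancel tendsto_norm_zero_iff by blast
qed

text \<open>The kernel of the resolvent: its integral against the semigroup turns out to be the
  inverse of \<open>\<alpha> - A\<close>.\<close>

abbreviation exp_decay :: "complex \<Rightarrow> real \<Rightarrow> complex" where
  "exp_decay \<alpha> \<equiv> (\<lambda>t. exp (- (\<alpha> * complex_of_real t)))"

lemma exp_decay_absolutely_integrable:
  assumes "0 < Re \<alpha>"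
  shows "exp_decay \<alpha> absolutely_integrable_on {0<..}"
proof (rule measurable_bounded_by_integrable_imp_absolutely_integrable)
  show "exp_decay \<alpha> \<in> borel_measurable (lebesgue_on {0<..})"
    by (intro continuous_imp_measurable_on_sets_lebesgue continuous_intros) simp
  have "(\<lambda>t. exp (- Re \<alpha> * t)) integrable_on {0..}"
    by (rule integrable_on_exp_minus_to_infinity[OF assms])
  then show "(\<lambda>t. exp (- Re \<alpha> * t)) integrable_on {0<..}"
    by (rule integrable_spike_set) (auto intro: negligible_subset[of "{0}"])
qed auto

text \<open>Trades \<open>inv_into\<close> for an element of the operator algebra, so that
  resolvents can be exhibited by formulas; the left inverse identity is confined to
  \<open>D\<close>.\<close>

lemma Spec_iff:
  "z \<notin> Spec D A \<longleftrightarrow> (\<exists>B. (\<forall>x\<in>D. app B (z *\<^sub>C x - A x) = x) \<and>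
    (\<forall>y. app B y \<in> D \<and> z *\<^sub>C app B y - A (app B y) = y))"
proof -
  define F where "F x = z *\<^sub>C x - A x" for x
  have "bij_betw F D UNIV \<and> bounded_clinear (inv_into D F) \<longleftrightarrow>
    (\<exists>B. (\<forall>x\<in>D. app B (F x) = x) \<and> (\<forall>y. app B y \<in> D \<and> F (app B y) = y))"
  proof (intro iffI; elim conjE exE)
    assume F: "bij_betw F D UNIV" and "bounded_clinear (inv_into D F)"
    then show "\<exists>B. (\<forall>x\<in>D. app B (F x) = x) \<and> (\<forall>y. app B y \<in> D \<and> F (app B y) = y)"
      by (intro exI[of _ "Cop (inv_into D F)"])
        (auto simp: app_Cop bij_betw_inv_into_left bij_betw_inv_into_right
          intro!: bij_betw_apply[OF bij_betw_inv_into[OF F]])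
  next
    fix B assume B: "\<forall>x\<in>D. app B (F x) = x" "\<forall>y. app B y \<in> D \<and> F (app B y) = y"
    then have F: "bij_betw F D UNIV"
      by (intro bij_betwI[where g = "app B"]) auto
    moreover have "inv_into D F = app B"
      using B F by (metis bij_betw_def inv_into_f_f ext)
    ultimately show "bij_betw F D UNIV \<and> bounded_clinear (inv_into D F)"
      by simp
  qed
  then show ?thesis by (simp add: Spec_def F_def[abs_def])
qed

text \<open>\<open>M_nonneg\<close> is stated apart because over the zero space \<open>bound\<close>
  holds for every real \<open>M\<close>.\<close>

locale bounded_semigroup =
  fixes T :: "real \<Rightarrow> 'a::complex_banach \<Rightarrow> 'a" and M :: real
  assumes semigroup: "one_parameter_semigroup T"
    and bound: "0 \<le> t \<Longrightarrow> norm (T t x) \<le> M * norm x"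
    and M_nonneg: "0 \<le> M"
begin

lemma T_clinear: "0 \<le> t \<Longrightarrow> bounded_clinear (T t)"
  and T_0: "T 0 x = x"
  and T_add: "0 \<le> s \<Longrightarrow> 0 \<le> t \<Longrightarrow> T (s + t) x = T s (T t x)"
  and T_continuous: "continuous_on {0..} (\<lambda>t. T t x)"
  using semigroup by (auto simp: one_parameter_semigroup_def)

lemmas T_linear = bounded_clinear_add[OF T_clinear] bounded_clinear_diff[OF T_clinear]
  bounded_clinear_scaleC[OF T_clinear]

text \<open>With a continuous \<open>H\<close> vanishing from \<open>b\<close> on in place of
  \<open>f\<close>, the integrand is continuous on a compact interval. The error is dominated by a
  multiple of the scalar function \<open>cmod (f t - H t)\<close>, as the passage to the limit
  requires.\<close>

lemma integrable_semigroup: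
  assumes f: "f absolutely_integrable_on {0<..}"
  shows "(\<lambda>t. f t *\<^sub>C T t x) integrable_on {0<..}"
proof (rule integrable_L1_limit)
  fix e :: real assume e: "0 < e"
  define m where "m = M * norm x + 1"
  have m: "0 < m" using M_nonneg by (simp add: m_def add_nonneg_pos)
  obtain H b where H: "continuous_on UNIV H" "\<And>t. b \<le> t \<Longrightarrow> H t = 0"
    "H absolutely_integrable_on {0<..}" "integral {0<..} (\<lambda>t. cmod (f t - H t)) < e / m"
    using L1_approx_continuous[OF f, of "e / m"] e m by auto
  have fH: "(\<lambda>t. cmod (f t - H t)) integrable_on {0<..}"
    using set_integral_diff(1)[OF f H(3)] by (simp add: absolutely_integrable_on_def)
  have "(\<lambda>t. H t *\<^sub>C T t x) integrable_on {0..b}"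
    by (intro integrable_continuous_real continuous_intros continuous_on_subset[OF H(1)]
        continuous_on_subset[OF T_continuous]) auto
  then have G: "(\<lambda>t. H t *\<^sub>C T t x) integrable_on {0<..}"
    by (rule integrable_spike_set) (auto simp: H(2) intro: negligible_subset[of "{0}"])
  have le: "norm (f t *\<^sub>C T t x - H t *\<^sub>C T t x) \<le> m * cmod (f t - H t)" if "t \<in> {0<..}" for t
  proof -
    have "norm (f t *\<^sub>C T t x - H t *\<^sub>C T t x) = cmod (f t - H t) * norm (T t x)"
      by (simp add: norm_scaleC flip: scaleC_diff_left)
    also have "\<dots> \<le> cmod (f t - H t) * m"
      using bound[of t x] that by (intro mult_left_mono) (auto simp: m_def)
    finally show ?thesis by (simp add: mult.commute)
  qed
  show "\<exists>G h. G integrable_on {0<..} \<and> h integrable_on {0<..} \<and>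
      (\<forall>t\<in>{0<..}. norm (f t *\<^sub>C T t x - G t) \<le> h t) \<and> integral {0<..} h < e"
    using G fH le H(4) m
    by (intro exI[of _ "\<lambda>t. H t *\<^sub>C T t x"] exI[of _ "\<lambda>t. m * cmod (f t - H t)"])
      (auto simp: integrable_on_mult_right field_simps)
qed

lemma norm_semigroup_integral_le:
  assumes f: "f absolutely_integrable_on {0<..}"
  shows "norm (semigroup_integral f T x) \<le> M * integral {0<..} (\<lambda>t. cmod (f t)) * norm x"
proof -
  have "norm (semigroup_integral f T x) \<le> integral {0<..} (\<lambda>t. (M * norm x) * cmod (f t))"
    unfolding semigroup_integral_def
  proof (rule integral_norm_bound_integral[OF integrable_semigroup[OF f]])
    show "(\<lambda>t. (M * norm x) * cmod (f t)) integrable_on {0<..}"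
      using f by (intro integrable_on_mult_right) (simp add: absolutely_integrable_on_def)
    show "norm (f t *\<^sub>C T t x) \<le> M * norm x * cmod (f t)" if "t \<in> {0<..}" for t
      using mult_right_mono[OF bound[of t x], of "cmod (f t)"] that by (simp add: norm_scaleC mult.commute)
  qed
  then show ?thesis by (simp add: mult_ac)
qed

lemma bounded_clinear_semigroup_integral:
  assumes f: "f absolutely_integrable_on {0<..}"
  shows "bounded_clinear (semigroup_integral f T)"
proof (rule bounded_clinearI)
  note int = integrable_semigroup[OF f]
  show "semigroup_integral f T (x + y) = semigroup_integral f T x + semigroup_integral f T y" for x y
  proof -
    have "semigroup_integral f T (x + y) = integral {0<..} (\<lambda>t. f t *\<^sub>C T t x + f t *\<^sub>C T t y)"
      unfolding semigroup_integral_def by (intro integral_cong) (simp add: T_linear scaleC_algebra)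
    then show ?thesis by (simp add: integral_add int semigroup_integral_def)
  qed
  show "semigroup_integral f T (c *\<^sub>C x) = c *\<^sub>C semigroup_integral f T x" for c x
  proof -
    have "semigroup_integral f T (c *\<^sub>C x) = integral {0<..} ((\<lambda>x. c *\<^sub>C x) \<circ> (\<lambda>t. f t *\<^sub>C T t x))"
      unfolding semigroup_integral_def
      by (intro integral_cong) (simp add: T_linear scaleC_scaleC mult.commute)
    then show ?thesis
      by (simp add: integral_linear[OF int bounded_linear_scaleC_right] semigroup_integral_def)
  qed
qed (rule norm_semigroup_integral_le[OF f])

definition X :: "(real \<Rightarrow> complex) \<Rightarrow> 'a cop" where
  "X f = Cop (semigroup_integral f T)"

lemma app_X: "f absolutely_integrable_on {0<..} \<Longrightarrow> app (X f) = semigroup_integral f T"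
  by (simp add: X_def app_Cop bounded_clinear_semigroup_integral)

lemma norm_X_le:
  assumes "f absolutely_integrable_on {0<..}"
  shows "norm (X f) \<le> M * integral {0<..} (\<lambda>t. cmod (f t))"
  using assms M_nonneg
  by (intro norm_cop_le)
    (auto simp: app_X norm_semigroup_integral_le integral_nonneg absolutely_integrable_on_def)

lemma X_diff:
  assumes "f absolutely_integrable_on {0<..}" "g absolutely_integrable_on {0<..}"
  shows "X (\<lambda>t. f t - g t) = X f - X g"
proof (rule cop_eqI)
  have "(\<lambda>t. f t - g t) absolutely_integrable_on {0<..}"
    using set_integral_diff(1)[OF assms] .
  then show "app (X (\<lambda>t. f t - g t)) x = app (X f - X g) x" for x
    using assms by (simp add: app_X semigroup_integral_def scaleC_diff_left integral_diff integrable_semigroup)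
qed

lemma X_add:
  assumes "f absolutely_integrable_on {0<..}" "g absolutely_integrable_on {0<..}"
  shows "X (\<lambda>t. f t + g t) = X f + X g"
proof (rule cop_eqI)
  have "(\<lambda>t. f t + g t) absolutely_integrable_on {0<..}"
    using set_integral_add(1)[OF assms] .
  then show "app (X (\<lambda>t. f t + g t)) x = app (X f + X g) x" for x
    using assms by (simp add: app_X semigroup_integral_def scaleC_add_left integral_add integrable_semigroup)
qed

lemma X_mult:
  assumes "f absolutely_integrable_on {0<..}"
  shows "X (\<lambda>t. c * f t) = c *\<^sub>C X f"
proof (rule cop_eqI)
  have "(\<lambda>t. c * f t) absolutely_integrable_on {0<..}"
    using assms by simp
  then show "app (X (\<lambda>t. c * f t)) x = app (c *\<^sub>C X f) x" for x
    using integral_linear[OF integrable_semigroup[OF assms, of x] bounded_linear_scaleC_right[of c]] assms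
    by (simp add: app_X semigroup_integral_def o_def scaleC_scaleC)
qed

text \<open>Applied twice: with a semigroup operator as \<open>B\<close> it yields
  \<open>X_T\<close>, which in turn admits another integral as \<open>B\<close> and yields
  \<open>X_commute\<close>.\<close>

lemma commutes_X:
  assumes f: "f absolutely_integrable_on {0<..}"
    and B: "\<And>t x. 0 \<le> t \<Longrightarrow> app B (T t x) = T t (app B x)"
  shows "B * X f = X f * B"
proof (rule cop_eqI)
  fix x
  have "app B (semigroup_integral f T x) = integral {0<..} (app B \<circ> (\<lambda>t. f t *\<^sub>C T t x))"
    unfolding semigroup_integral_def
    by (rule integral_linear[symmetric, OF integrable_semigroup[OF f]])
      (simp add: bounded_clinear_bounded_linear)
  also have "\<dots> = semigroup_integral f T (app B x)"
    unfolding semigroup_integral_def by (intro integral_cong) (simp add: app_linear B)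
  finally show "app (B * X f) x = app (X f * B) x"
    using f by (simp add: app_X)
qed

lemma X_T:
  assumes f: "f absolutely_integrable_on {0<..}" and t: "0 \<le> t"
  shows "app (X f) (T t x) = T t (app (X f) x)"
proof -
  have "T t (T s x) = T s (T t x)" if "0 \<le> s" for s x
    using T_add[OF t that] T_add[OF that t] by (simp add: add.commute)
  then have "Cop (T t) * X f = X f * Cop (T t)"
    using t by (intro commutes_X[OF f]) (simp add: app_Cop T_clinear)
  then have "app (Cop (T t) * X f) x = app (X f * Cop (T t)) x" by simp
  then show ?thesis using t by (simp add: app_Cop T_clinear)
qed

lemma X_commute:
  assumes "f absolutely_integrable_on {0<..}" "g absolutely_integrable_on {0<..}"
  shows "X f * X g = X g * X f"
  using assms by (intro commutes_X X_T)

section \<open>The resolvent of the generator\<close>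

text \<open>Shifting the integration variable by \<open>h\<close> leaves the tail of the integral
  beyond \<open>h\<close>. Written as the whole minus the part over \<open>{0..h}\<close>, it
  depends on \<open>h\<close> only through a continuous integrand on a compact interval, hence can
  be differentiated at 0.\<close>

lemma T_X_exp_decay:
  assumes \<alpha>: "0 < Re \<alpha>" and h: "0 \<le> h"
  shows "T h (app (X (exp_decay \<alpha>)) x) = exp (\<alpha> * complex_of_real h) *\<^sub>C
    (app (X (exp_decay \<alpha>)) x - integral {0..h} (\<lambda>t. exp_decay \<alpha> t *\<^sub>C T t x))"
proof -
  note f = exp_decay_absolutely_integrable[OF \<alpha>]
  define \<phi> where "\<phi> t = exp_decay \<alpha> t *\<^sub>C T t x" for t
  define I where "I = app (X (exp_decay \<alpha>)) x"
  have I: "(\<phi> has_integral I) {0<..}"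
    using integrable_integral[OF integrable_semigroup[OF f, of x]]
    by (simp add: I_def app_X f semigroup_integral_def \<phi>_def[abs_def])
  have "\<phi> integrable_on {0..h}"
    unfolding \<phi>_def
    by (intro integrable_continuous_real continuous_intros continuous_on_subset[OF T_continuous]) auto
  then have "(\<phi> has_integral integral {0..h} \<phi>) {0..h}"
    by (rule integrable_integral)
  then have "(\<phi> has_integral integral {0..h} \<phi>) {0<..h}"
    by (subst has_integral_spike_set_eq[where T = "{0..h}"]) (auto intro: negligible_subset[of "{0}"])
  then have "((\<lambda>t. (if t \<in> {0<..} then \<phi> t else 0) - (if t \<in> {0<..h} then \<phi> t else 0))
      has_integral (I - integral {0..h} \<phi>)) UNIV"
    using I by (intro has_integral_diff) (simp_all only: has_integral_restrict_UNIV)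
  moreover have "(\<lambda>t. (if t \<in> {0<..} then \<phi> t else 0) - (if t \<in> {0<..h} then \<phi> t else 0))
      = (\<lambda>t. if h < t then \<phi> t else 0)"
    using h by (auto simp: fun_eq_iff)
  ultimately have "((\<lambda>t. if h < t then \<phi> t else 0) has_integral (I - integral {0..h} \<phi>)) UNIV"
    by simp
  from has_integral_shift_UNIV[OF this, of h]
  have "((\<lambda>t. if t \<in> {0<..} then \<phi> (t + h) else 0) has_integral (I - integral {0..h} \<phi>)) UNIV"
    by simp
  then have "((\<lambda>t. \<phi> (t + h)) has_integral (I - integral {0..h} \<phi>)) {0<..}"
    by (simp only: has_integral_restrict_UNIV)
  from has_integral_linear[OF this bounded_linear_scaleC_right[of "exp (\<alpha> * complex_of_real h)"]]
  have "((\<lambda>t. exp (\<alpha> * complex_of_real h) *\<^sub>C \<phi> (t + h)) has_integral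
      exp (\<alpha> * complex_of_real h) *\<^sub>C (I - integral {0..h} \<phi>)) {0<..}"
    by (simp add: o_def)
  moreover have "exp (\<alpha> * complex_of_real h) *\<^sub>C \<phi> (t + h) = T h (\<phi> t)" if "t \<in> {0<..}" for t
  proof -
    have "exp (\<alpha> * complex_of_real h) * exp_decay \<alpha> (t + h) = exp_decay \<alpha> t"
      by (simp add: algebra_simps flip: exp_add)
    moreover have "T (t + h) x = T h (T t x)"
      using T_add[of h t x] h that by (simp add: add.commute)
    ultimately show ?thesis
      using h by (simp add: \<phi>_def scaleC_scaleC T_linear)
  qed
  ultimately have 1: "((\<lambda>t. T h (\<phi> t)) has_integral
      exp (\<alpha> * complex_of_real h) *\<^sub>C (I - integral {0..h} \<phi>)) {0<..}"
    by (subst (asm) has_integral_cong) auto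
  have "((\<lambda>t. T h (\<phi> t)) has_integral T h I) {0<..}"
    using has_integral_linear[OF I bounded_clinear_bounded_linear[OF T_clinear[OF h]]] by (simp add: o_def)
  from has_integral_unique[OF this 1] show ?thesis
    by (simp add: I_def \<phi>_def[abs_def])
qed

text \<open>The product rule at \<open>h = 0\<close> in the preceding formula: the exponential
  contributes \<open>\<alpha> *\<^sub>C app R x\<close> and the integral over \<open>{0..h}\<close>
  contributes \<open>- x\<close>.\<close>

lemma X_exp_decay_quotient:
  assumes \<alpha>: "0 < Re \<alpha>"
  defines "R \<equiv> X (exp_decay \<alpha>)"
  shows "((\<lambda>h. (T h (app R x) - app R x) /\<^sub>R h) \<longlongrightarrow> \<alpha> *\<^sub>C app R x - x) (at_right 0)"
proof -
  define \<phi> where "\<phi> t = exp_decay \<alpha> t *\<^sub>C T t x" for t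
  define V where "V h = integral {0..h} \<phi>" for h
  define F where "F h = exp (\<alpha> * complex_of_real h) *\<^sub>C (app R x - V h)" for h
  have \<phi>: "continuous_on {0..1} \<phi>"
    unfolding \<phi>_def by (intro continuous_intros continuous_on_subset[OF T_continuous]) auto
  have V: "(V has_vector_derivative x) (at 0 within {0..1})"
    unfolding V_def using integral_has_vector_derivative[OF \<phi>, of 0] by (simp add: \<phi>_def T_0)
  have E: "((\<lambda>h. exp (\<alpha> * complex_of_real h)) has_vector_derivative \<alpha>) (at 0 within {0..1})"
    by (auto intro!: derivative_eq_intros has_vector_derivative_real_field)
  have "(F has_vector_derivative (1 *\<^sub>C (0 - x) + \<alpha> *\<^sub>C (app R x - 0))) (at 0 within {0..1})"
    unfolding F_def
    using bounded_bilinear.has_vector_derivative[OF bounded_bilinear_scaleC E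
        has_vector_derivative_diff[OF has_vector_derivative_const[of "app R x"] V]]
    by (simp add: V_def)
  from has_vector_derivative_quotient[OF this]
  have "((\<lambda>h. (F h - F 0) /\<^sub>R h) \<longlongrightarrow> \<alpha> *\<^sub>C app R x - x) (at_right 0)" by simp
  moreover have "\<forall>\<^sub>F h in at_right 0. (F h - F 0) /\<^sub>R h = (T h (app R x) - app R x) /\<^sub>R h"
    unfolding eventually_at_right_field
    by (intro exI[of _ 1])
      (auto simp: F_def V_def R_def \<phi>_def[abs_def] T_X_exp_decay[OF \<alpha>])
  ultimately show ?thesis
    by (rule Lim_transform_eventually)
qed

abbreviation "D \<equiv> generator_domain T"
abbreviation "A \<equiv> generator T"

lemma generatorI:
  assumes "((\<lambda>h. (T h x - x) /\<^sub>R h) \<longlongrightarrow> y) (at_right 0)"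
  shows "x \<in> D" "A x = y"
  using assms tendsto_Lim[OF trivial_limit_at_right_real]
  by (auto simp: generator_domain_def generator_def)

lemma generatorD:
  assumes "x \<in> D"
  shows "((\<lambda>h. (T h x - x) /\<^sub>R h) \<longlongrightarrow> A x) (at_right 0)"
  using assms generatorI(2) by (auto simp: generator_domain_def)

lemma resolvent_right:
  assumes "0 < Re \<alpha>"
  shows "app (X (exp_decay \<alpha>)) x \<in> D"
    and "\<alpha> *\<^sub>C app (X (exp_decay \<alpha>)) x - A (app (X (exp_decay \<alpha>)) x) = x"
  using generatorI[OF X_exp_decay_quotient[OF assms, of x]] by auto

text \<open>The resolvent commutes with the semigroup, so applied to the difference quotient of
  \<open>x\<close> it gives that of \<open>app R x\<close>, whose limit is known.\<close>

lemma resolvent_left: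
  assumes \<alpha>: "0 < Re \<alpha>" and x: "x \<in> D"
  shows "app (X (exp_decay \<alpha>)) (\<alpha> *\<^sub>C x - A x) = x"
proof -
  define R where "R = X (exp_decay \<alpha>)"
  have "((\<lambda>h. app R ((T h x - x) /\<^sub>R h)) \<longlongrightarrow> app R (A x)) (at_right 0)"
    by (rule bounded_linear.tendsto[OF bounded_clinear_bounded_linear generatorD[OF x]]) simp
  moreover have "\<forall>\<^sub>F h in at_right 0. app R ((T h x - x) /\<^sub>R h) = (T h (app R x) - app R x) /\<^sub>R h"
    unfolding eventually_at_right_field
    by (intro exI[of _ 1])
      (auto simp: R_def bounded_clinear_scaleR app_linear X_T exp_decay_absolutely_integrable[OF \<alpha>])
  ultimately have "((\<lambda>h. (T h (app R x) - app R x) /\<^sub>R h) \<longlongrightarrow> app R (A x)) (at_right 0)"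
    by (rule Lim_transform_eventually)
  from tendsto_unique[OF trivial_limit_at_right_real this[unfolded R_def] X_exp_decay_quotient[OF \<alpha>]]
  have "app R (A x) = \<alpha> *\<^sub>C app R x - x"
    by (simp only: R_def)
  then show ?thesis
    by (simp add: app_linear flip: R_def)
qed

lemma Re_Spec_generator:
  assumes "z \<in> Spec D A"
  shows "Re z \<le> 0"
proof (rule ccontr)
  assume "\<not> Re z \<le> 0"
  then have "0 < Re z" by simp
  then have "z \<notin> Spec D A"
    unfolding Spec_iff by (intro exI[of _ "X (exp_decay z)"]) (simp add: resolvent_left resolvent_right)
  with assms show False by simp
qed

definition R :: "'a cop" where "R = X (exp_decay 1)"

lemma R_right: "app R x \<in> D" "app R x - A (app R x) = x"
  using resolvent_right[of 1 x] by (simp_all add: R_def)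

lemma R_left: "x \<in> D \<Longrightarrow> app R (x - A x) = x"
  using resolvent_left[of 1 x] by (simp add: R_def)

text \<open>On \<open>D\<close> one has w (z - A) = (w - R) (1 - A) with z = 1 - 1/w, and 1 - A is
  inverted by \<open>R\<close>; each inverse is read off from the other.\<close>

lemma Spec_R_iff:
  assumes w: "w \<noteq> 0"
  shows "w \<in> Spec UNIV (app R) \<longleftrightarrow> 1 - 1 / w \<in> Spec D A"
proof -
  define z where "z = 1 - 1 / w"
  have shift: "z *\<^sub>C x - A x = (x - A x) - (1 / w) *\<^sub>C x" for x
    by (simp add: z_def scaleC_algebra)
  have "unit_op (w *\<^sub>C 1 - R) \<longleftrightarrow> z \<notin> Spec D A"
  proof
    assume "unit_op (w *\<^sub>C 1 - R)"
    then obtain b where "(w *\<^sub>C 1 - R) * b = 1" "b * (w *\<^sub>C 1 - R) = 1"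
      by (auto simp: unit_op_def)
    then have b: "w *\<^sub>C app b y - app R (app b y) = y" "app b (w *\<^sub>C y - app R y) = y" for y
      by (metis app_simps(2,4,6,7))+
    \<comment> \<open>Inverting both sides of w (z - A) = (w - R) (1 - A).\<close>
    define B where "B = R * (w *\<^sub>C b)"
    have "app B (z *\<^sub>C x - A x) = x" if x: "x \<in> D" for x
    proof -
      have "w *\<^sub>C (z *\<^sub>C x - A x) = w *\<^sub>C (x - A x) - app R (x - A x)"
        using w by (simp add: shift R_left[OF x] scaleC_algebra)
      then have "app b (w *\<^sub>C (z *\<^sub>C x - A x)) = x - A x"
        by (simp add: b)
      moreover have "app B (z *\<^sub>C x - A x) = app R (app b (w *\<^sub>C (z *\<^sub>C x - A x)))"
        by (simp add: B_def app_linear(3))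
      ultimately show ?thesis
        by (simp add: R_left[OF x])
    qed
    moreover have "z *\<^sub>C app B y - A (app B y) = y" for y
    proof -
      have "z *\<^sub>C app B y - A (app B y) = w *\<^sub>C app b y - (1 / w) *\<^sub>C app R (w *\<^sub>C app b y)"
        unfolding shift B_def app_simps(6,7) R_right(2) ..
      then show ?thesis using w by (simp add: app_linear(3) scaleC_scaleC b)
    qed
    moreover have "app B y \<in> D" for y
      unfolding B_def app_simps(6) by (rule R_right)
    ultimately show "z \<notin> Spec D A"
      unfolding Spec_iff by blast
  next
    assume "z \<notin> Spec D A"
    then obtain B where B: "\<And>x. x \<in> D \<Longrightarrow> app B (z *\<^sub>C x - A x) = x" "\<And>y. app B y \<in> D"
      "\<And>y. z *\<^sub>C app B y - A (app B y) = y"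
      unfolding Spec_iff by blast
    \<comment> \<open>The inverse of w - R is (1 - A) B / w, and (1 - A) B = 1 + B / w because (z -
      A) B = 1.\<close>
    define b where "b = (1 / w) *\<^sub>C (1 + (1 / w) *\<^sub>C B)"
    have "(w *\<^sub>C 1 - R) * b = 1"
    proof (rule cop_eqI)
      fix y
      have "app B y - A (app B y) = y + (1 / w) *\<^sub>C app B y"
        using B(3)[of y] by (simp add: shift algebra_simps)
      then have "app R (y + (1 / w) *\<^sub>C app B y) = app B y"
        using R_left[OF B(2)] by metis
      moreover have b: "app b y = (1 / w) *\<^sub>C (y + (1 / w) *\<^sub>C app B y)"
        by (simp add: b_def)
      ultimately have "app R (app b y) = (1 / w) *\<^sub>C app B y"
        by (simp only: app_linear(3))
      then show "app ((w *\<^sub>C 1 - R) * b) y = app 1 y"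
        using w by (simp add: b scaleC_algebra)
    qed
    moreover have "b * (w *\<^sub>C 1 - R) = 1"
    proof (rule cop_eqI)
      fix y
      have "w *\<^sub>C y - app R y = w *\<^sub>C (z *\<^sub>C app R y - A (app R y))"
        unfolding shift using w by (simp add: R_right scaleC_algebra)
      then have "app B (w *\<^sub>C y - app R y) = w *\<^sub>C app R y"
        by (simp add: app_linear(3) B(1) R_right)
      then show "app (b * (w *\<^sub>C 1 - R)) y = app 1 y"
        using w by (simp add: b_def scaleC_algebra)
    qed
    ultimately show "unit_op (w *\<^sub>C 1 - R)"
      by (auto simp: unit_op_def)
  qed
  then show ?thesis by (simp add: Spec_UNIV_iff z_def)
qed

text \<open>A bounded inverse of \<open>R\<close> would extend 1 - A, and \<open>A\<close> would be
  bounded on \<open>D\<close>.\<close>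

lemma zero_in_Spec_R:
  assumes "unbounded_operator D A"
  shows "0 \<in> Spec UNIV (app R)"
  unfolding Spec_UNIV_iff
proof
  assume "unit_op (0 *\<^sub>C 1 - R)"
  then obtain b where "b * (0 *\<^sub>C 1 - R) = 1"
    by (auto simp: unit_op_def)
  then have b: "app b (- app R y) = y" for y
    by (metis app_simps(2,4,6,7) diff_0 scaleC_zero_left)
  have "norm (A x) \<le> (1 + norm b) * norm x" if x: "x \<in> D" for x
  proof -
    have "app b (- x) = x - A x"
      using b[of "x - A x"] R_left[OF x] by simp
    then have "norm (x - A x) \<le> norm b * norm x"
      using norm_app[of b "- x"] by simp
    then show ?thesis
      using norm_triangle_ineq4[of x "x - A x"] by (simp add: algebra_simps)
  qed
  with assms show False
    unfolding unbounded_operator_def by blast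
qed

section \<open>Exponential sums as rational functions of the resolvent\<close>

definition exp_sum :: "(nat \<Rightarrow> complex) \<Rightarrow> nat \<Rightarrow> real \<Rightarrow> complex" where
  "exp_sum c n t = (\<Sum>k<n. c k * exp_decay (of_nat (Suc k)) t)"

lemma exp_sum_absolutely_integrable: "exp_sum c n absolutely_integrable_on {0<..}"
  unfolding exp_sum_def
  by (intro absolutely_integrable_sum set_integrable_mult_right exp_decay_absolutely_integrable) auto

lemma X_exp_sum: "X (exp_sum c n) = (\<Sum>k<n. c k *\<^sub>C X (exp_decay (of_nat (Suc k))))"
proof (induction n)
  case 0
  have "X (\<lambda>t. 0 * exp_decay 1 t) = 0 *\<^sub>C X (exp_decay 1)"
    by (intro X_mult exp_decay_absolutely_integrable) simp
  then show ?case by (simp add: exp_sum_def[abs_def])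
next
  case (Suc n)
  have e: "exp_decay (of_nat (Suc n)) absolutely_integrable_on {0<..}"
    by (rule exp_decay_absolutely_integrable) simp
  have "X (exp_sum c (Suc n)) = X (\<lambda>t. exp_sum c n t + c n * exp_decay (of_nat (Suc n)) t)"
    by (simp add: exp_sum_def[abs_def])
  also have "\<dots> = X (exp_sum c n) + c n *\<^sub>C X (exp_decay (of_nat (Suc n)))"
    using e by (subst X_add) (auto intro!: exp_sum_absolutely_integrable X_mult)
  finally show ?case by (simp add: Suc)
qed

text \<open>Since (1 - A) R = 1, the factor 1 + k R equals (k + 1 - A) R, and the resolvent at k + 1
  cancels. So that resolvent is the function w / (1 + k w) of \<open>R\<close>.\<close>

lemma X_exp_decay_R:
  "X (exp_decay (of_nat (Suc k))) * (1 + of_nat k *\<^sub>C R) = R"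
proof (rule cop_eqI)
  fix y
  have "app (1 + of_nat k *\<^sub>C R) y = of_nat (Suc k) *\<^sub>C app R y - A (app R y)"
    using R_right(2)[of y] by (simp add: scaleC_algebra algebra_simps)
  then show "app (X (exp_decay (of_nat (Suc k))) * (1 + of_nat k *\<^sub>C R)) y = app R y"
    by (simp only: app_simps(6)) (rule resolvent_left, simp_all add: R_right)
qed

lemma X_exp_sum_rational:
  "\<exists>p q. X (exp_sum c n) * peval q R = peval p R \<and>
    (\<forall>w. (\<forall>k<n. 1 + of_nat k * w \<noteq> 0) \<longrightarrow> poly q w \<noteq> 0 \<and>
      poly p w / poly q w = (\<Sum>k<n. c k * (w / (1 + of_nat k * w))))"
proof (induction n)
  case 0
  show ?case by (intro exI[of _ 0] exI[of _ 1]) (simp add: X_exp_sum)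
next
  case (Suc n)
  then obtain p q where pq: "X (exp_sum c n) * peval q R = peval p R"
    "\<And>w. (\<forall>k<n. 1 + of_nat k * w \<noteq> 0) \<Longrightarrow> poly q w \<noteq> 0 \<and>
      poly p w / poly q w = (\<Sum>k<n. c k * (w / (1 + of_nat k * w)))"
    by blast
  \<comment> \<open>The new fraction c_n w / (1 + n w) is added over the common denominator
    \<open>q * l\<close>.\<close>
  define l :: "complex poly" where "l = [:1, of_nat n:]"
  define p' where "p' = p * l + smult (c n) ([:0, 1:] * q)"
  have l: "peval l R = 1 + of_nat n *\<^sub>C R" "peval [:0, 1:] R = R"
    by (simp_all add: l_def)
  have "X (exp_sum c (Suc n)) * peval (q * l) R
    = X (exp_sum c n) * peval q R * peval l R + c n *\<^sub>C (X (exp_decay (of_nat (Suc n))) * peval l R * peval q R)"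
    by (simp add: X_exp_sum distrib_right mult.assoc flip: peval_mult) (simp add: mult.commute[of q l])
  also have "\<dots> = peval p' R"
    by (simp only: pq l X_exp_decay_R p'_def peval_add peval_smult peval_mult)
  finally have 1: "X (exp_sum c (Suc n)) * peval (q * l) R = peval p' R" .
  have 2: "poly (q * l) w \<noteq> 0 \<and> poly p' w / poly (q * l) w = (\<Sum>k<Suc n. c k * (w / (1 + of_nat k * w)))"
    if w: "\<forall>k<Suc n. 1 + of_nat k * w \<noteq> 0" for w
  proof -
    have q: "poly q w \<noteq> 0" "poly p w / poly q w = (\<Sum>k<n. c k * (w / (1 + of_nat k * w)))"
      and n: "1 + of_nat n * w \<noteq> 0"
      using w pq(2)[of w] by auto
    have "poly p' w / poly (q * l) w = poly p w / poly q w + c n * (w / (1 + of_nat n * w))"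
      using q(1) n by (simp add: p'_def l_def add_frac_eq algebra_simps)
    moreover have "poly (q * l) w = poly q w * (1 + of_nat n * w)"
      by (simp add: l_def algebra_simps)
    ultimately show ?thesis
      using q n by simp
  qed
  show ?case
    using 1 2 by blast
qed

text \<open>A pole w = -1/k of the symbol would correspond to the spectral value 1 - 1/w = 1 + k of
  the generator, which lies in the open right half-plane.\<close>

lemma Spec_X_exp_sum:
  assumes "Spec UNIV (app R) \<noteq> {}"
  shows "Spec UNIV (app (X (exp_sum c n))) =
    (\<lambda>w. \<Sum>k<n. c k * (w / (1 + of_nat k * w))) ` Spec UNIV (app R)"
    and "w \<in> Spec UNIV (app R) \<Longrightarrow> 1 + of_nat k * w \<noteq> 0"
proof -
  show nz: "1 + of_nat k * w \<noteq> 0" if w: "w \<in> Spec UNIV (app R)" for w k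
  proof
    assume 0: "1 + of_nat k * w = 0"
    then have "w \<noteq> 0" by auto
    moreover have "1 - 1 / w = 1 + of_nat k"
      using 0 \<open>w \<noteq> 0\<close> by (simp add: field_simps eq_neg_iff_add_eq_0)
    ultimately have "1 + of_nat k \<in> Spec D A"
      using w Spec_R_iff by metis
    from Re_Spec_generator[OF this] show False by simp
  qed
  obtain p q where pq: "X (exp_sum c n) * peval q R = peval p R"
    "\<And>w. (\<forall>k<n. 1 + of_nat k * w \<noteq> 0) \<Longrightarrow> poly q w \<noteq> 0 \<and>
      poly p w / poly q w = (\<Sum>k<n. c k * (w / (1 + of_nat k * w)))"
    using X_exp_sum_rational by blast
  have "Spec UNIV (app (X (exp_sum c n))) = (\<lambda>w. poly p w / poly q w) ` Spec UNIV (app R)"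
    using nz pq(2) by (intro Spec_rational[OF assms _ pq(1)]) blast
  also have "\<dots> = (\<lambda>w. \<Sum>k<n. c k * (w / (1 + of_nat k * w))) ` Spec UNIV (app R)"
    using nz pq(2) by (intro image_cong) auto
  finally show "Spec UNIV (app (X (exp_sum c n))) = \<dots>" .
qed

end

section \<open>The Laplace transform\<close>

text \<open>On the Banach space of complex numbers \<open>exp (z t)\<close> is a bounded semigroup with generator
  \<open>z\<close>, whose integrals are the values of the Laplace transform at \<open>z\<close>.\<close>

lemma exp_semigroup:
  assumes "Re z \<le> 0"
  shows "bounded_semigroup (\<lambda>t x. exp (z * complex_of_real t) * x) 1"
proof
  show "one_parameter_semigroup (\<lambda>t x. exp (z * complex_of_real t) * x)"
    unfolding one_parameter_semigroup_def
  proof (intro conjI allI impI)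
    show "bounded_clinear (\<lambda>x. exp (z * complex_of_real t) * x)" for t
      by (rule bounded_clinearI[where C = "cmod (exp (z * complex_of_real t))"])
        (simp_all add: scaleC_complex_def algebra_simps norm_mult)
  qed (auto simp: fun_eq_iff algebra_simps exp_add intro!: continuous_intros)
  show "norm (exp (z * complex_of_real t) * x) \<le> 1 * norm x" if "0 \<le> t" for t x
    using assms that by (simp add: norm_mult mult_left_le_one_le mult_nonpos_nonneg)
qed simp

context
  fixes z :: complex
  assumes z: "Re z \<le> 0"
begin

interpretation bounded_semigroup "\<lambda>t x. exp (z * complex_of_real t) * x" 1
  by (rule exp_semigroup[OF z])

lemma laplace_hat_eq_X: "f absolutely_integrable_on {0<..} \<Longrightarrow> laplace_hat f z = app (X f) 1"
  by (simp add: app_X semigroup_integral_def laplace_hat_def scaleC_complex_def)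

text \<open>The scalar semigroup has bound 1 for every admissible \<open>z\<close>, so the estimate
  is uniform in \<open>z\<close>.\<close>

lemma norm_laplace_hat_diff_le:
  assumes "f absolutely_integrable_on {0<..}" "g absolutely_integrable_on {0<..}"
  shows "cmod (laplace_hat f z - laplace_hat g z) \<le> integral {0<..} (\<lambda>t. cmod (f t - g t))"
proof -
  have "laplace_hat f z - laplace_hat g z = app (X (\<lambda>t. f t - g t)) 1"
    using assms by (simp add: laplace_hat_eq_X X_diff)
  also have "cmod \<dots> \<le> norm (X (\<lambda>t. f t - g t)) * cmod 1"
    by (rule norm_app)
  also have "\<dots> \<le> integral {0<..} (\<lambda>t. cmod (f t - g t))"
    using norm_X_le[OF set_integral_diff(1)[OF assms]] by simp
  finally show ?thesis .
qed

text \<open>The integral is identified as the resolvent of the scalar generator \<open>z\<close>,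
  which is division by \<open>\<alpha> - z\<close>.\<close>

lemma app_X_exp_decay_one:
  assumes \<alpha>: "0 < Re \<alpha>"
  shows "app (X (exp_decay \<alpha>)) 1 = 1 / (\<alpha> - z)"
proof -
  have "((\<lambda>h. exp (z * complex_of_real h)) has_vector_derivative z) (at 0 within {0..1})"
    by (auto intro!: derivative_eq_intros has_vector_derivative_real_field)
  from has_vector_derivative_quotient[OF this]
  have gen: "1 \<in> D" "A 1 = z"
    by (intro generatorI; simp)+
  have "app (X (exp_decay \<alpha>)) ((\<alpha> - z) *\<^sub>C 1) = 1"
    using resolvent_left[OF \<alpha> gen(1)] gen(2) by (simp add: scaleC_complex_def)
  then have "(\<alpha> - z) * app (X (exp_decay \<alpha>)) 1 = 1"
    by (simp add: app_linear(3)) (simp add: scaleC_complex_def)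
  moreover have "\<alpha> \<noteq> z" using \<alpha> z by auto
  ultimately show ?thesis by (simp add: field_simps)
qed

lemma laplace_hat_exp_sum: "laplace_hat (exp_sum c n) z = (\<Sum>k<n. c k / (of_nat (Suc k) - z))"
proof -
  have "app (\<Sum>k<n. c k *\<^sub>C X (exp_decay (of_nat (Suc k)))) 1 = (\<Sum>k<n. c k / (of_nat (Suc k) - z))"
    by (induction n) (simp_all add: scaleC_complex_def app_X_exp_decay_one del: of_nat_Suc)
  then show ?thesis
    by (simp add: laplace_hat_eq_X exp_sum_absolutely_integrable X_exp_sum)
qed

end

text \<open>Serves the function \<open>g\<close> below: its continuity at 0, a decay of the
  transform at infinity in the manner of Riemann and Lebesgue, is inherited from the rational
  approximants.\<close>

lemma continuous_on_uniform_approx: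
  fixes g :: "'a::topological_space \<Rightarrow> 'b::metric_space"
  assumes "\<And>e. 0 < e \<Longrightarrow> \<exists>h. continuous_on K h \<and> (\<forall>w\<in>K. dist (h w) (g w) < e)"
  shows "continuous_on K g"
proof -
  have "\<exists>h. continuous_on K h \<and> (\<forall>w\<in>K. dist (h w) (g w) < 1 / real (Suc n))" for n
    by (rule assms) simp
  then obtain h where h: "\<And>n. continuous_on K (h n)"
    "\<And>n w. w \<in> K \<Longrightarrow> dist (h n w) (g w) < 1 / real (Suc n)"
    by metis
  have "uniform_limit K h g sequentially"
    unfolding uniform_limit_iff
  proof (intro allI impI)
    fix e :: real assume "0 < e"
    then obtain N where N: "1 / real (Suc N) < e" using nat_approx_posE by blast
    have "dist (h n w) (g w) < e" if "N \<le> n" "w \<in> K" for n w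
    proof -
      have "1 / real (Suc n) \<le> 1 / real (Suc N)"
        using that(1) by (intro divide_left_mono) auto
      with h(2)[OF that(2), of n] N show ?thesis by linarith
    qed
    then show "\<forall>\<^sub>F n in sequentially. \<forall>w\<in>K. dist (h n w) (g w) < e"
      by (auto simp: eventually_sequentially)
  qed
  then show ?thesis
    by (rule uniform_limit_theorem[rotated]) (auto simp: h(1))
qed

section \<open>Spectral mapping for integrable kernels\<close>

context bounded_semigroup
begin

lemma Spec_X:
  assumes unb: "unbounded_operator D A" and f: "f absolutely_integrable_on {0<..}"
  shows "Spec UNIV (app (X f)) = {0} \<union> {laplace_hat f z | z. z \<in> Spec D A}"
proof -
  define K where "K = Spec UNIV (app R)"
  \<comment> \<open>The point \<open>w = 0\<close> stands for infinity on the side of the generator,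
    where the transform gets its limit value 0.\<close>
  define g where "g w = (if w = 0 then 0 else laplace_hat f (1 - 1 / w))" for w
  have 0: "0 \<in> K" using zero_in_Spec_R[OF unb] by (simp add: K_def)
  then have ne: "Spec UNIV (app R) \<noteq> {}" by (auto simp: K_def)
  have approx: "\<exists>Y h. Spec UNIV (app Y) = h ` K \<and> X f * Y = Y * X f \<and> norm (X f - Y) < e \<and>
      (\<forall>w\<in>K. cmod (h w - g w) < e) \<and> continuous_on K h" if e: "0 < e" for e
  proof -
    \<comment> \<open>Dividing \<open>e\<close> by \<open>M + 1\<close> bounds both errors by
      \<open>e\<close>: \<open>M * d\<close> for the operators and \<open>d\<close> for the
      transforms.\<close>
    have M1: "0 < M + 1" using M_nonneg by simp
    obtain c n where cn: "integral {0<..} (\<lambda>t. cmod (f t - exp_sum c n t)) < e / (M + 1)"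
      using L1_approx_exp[OF f, of "e / (M + 1)"] e M1 unfolding exp_sum_def by (metis divide_pos_pos)
    note E = exp_sum_absolutely_integrable[of c n]
    define d where "d = integral {0<..} (\<lambda>t. cmod (f t - exp_sum c n t))"
    have d: "0 \<le> d" unfolding d_def
      using set_integral_diff(1)[OF f E] by (intro integral_nonneg) (auto simp: absolutely_integrable_on_def)
    have dM: "d * (M + 1) < e"
      using cn M1 by (simp add: d_def pos_less_divide_eq)
    have "M * d \<le> d * (M + 1)" "d \<le> d * (M + 1)"
      using d M_nonneg by (auto simp: algebra_simps)
    with dM have small: "M * d < e" "d < e" by auto
    define h where "h w = (\<Sum>k<n. c k * (w / (1 + of_nat k * w)))" for w
    have Spec: "Spec UNIV (app (X (exp_sum c n))) = h ` K"
      unfolding K_def h_def by (rule Spec_X_exp_sum(1)[OF ne])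
    have "continuous_on K h"
      unfolding h_def K_def by (intro continuous_intros ballI Spec_X_exp_sum(2)[OF ne])
    moreover have "norm (X f - X (exp_sum c n)) < e"
      using norm_X_le[OF set_integral_diff(1)[OF f E]] small(1) by (simp add: X_diff f E d_def)
    moreover have "cmod (h w - g w) < e" if w: "w \<in> K" for w
    proof (cases "w = 0")
      case True
      then show ?thesis using e by (simp add: h_def g_def)
    next
      case False
      define z where "z = 1 - 1 / w"
      have "z \<in> Spec D A"
        using w Spec_R_iff[OF False] by (simp add: K_def z_def)
      then have z: "Re z \<le> 0" by (rule Re_Spec_generator)
      \<comment> \<open>Under z = 1 - 1/w the transform of the exponential sum becomes its rational
        symbol.\<close>
      have "c k / (of_nat (Suc k) - z) = c k * (w / (1 + of_nat k * w))" for k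
      proof -
        have "of_nat (Suc k) - z = (1 + of_nat k * w) / w"
          using False by (simp add: z_def field_simps)
        then show ?thesis by simp
      qed
      then have "h w = laplace_hat (exp_sum c n) z"
        by (simp only: laplace_hat_exp_sum[OF z] h_def)
      moreover have "g w = laplace_hat f z"
        using False by (simp add: g_def z_def)
      ultimately show ?thesis
        using norm_laplace_hat_diff_le[OF z f E] small(2) by (simp add: d_def norm_minus_commute)
    qed
    ultimately show ?thesis
      using Spec X_commute[OF f E] by blast
  qed
  have "Spec UNIV (app (X f)) = g ` K"
  proof (rule Spec_limit)
    show "compact K" unfolding K_def by (rule compact_Spec)
    show "continuous_on K g"
      by (rule continuous_on_uniform_approx) (use approx in \<open>fastforce simp: dist_norm\<close>)
  qed (use approx in blast)
  also have "\<dots> = {0} \<union> {laplace_hat f z | z. z \<in> Spec D A}"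
  proof (intro equalityI subsetI)
    fix \<mu> assume "\<mu> \<in> g ` K"
    then show "\<mu> \<in> {0} \<union> {laplace_hat f z | z. z \<in> Spec D A}"
      using Spec_R_iff by (auto simp: g_def K_def)
  next
    fix \<mu> assume "\<mu> \<in> {0} \<union> {laplace_hat f z | z. z \<in> Spec D A}"
    then consider "\<mu> = 0" | z where "z \<in> Spec D A" "\<mu> = laplace_hat f z" by blast
    then show "\<mu> \<in> g ` K"
    proof cases
      case 1
      then show ?thesis using 0 by (auto simp: g_def image_iff)
    next
      case 2
      \<comment> \<open>The spectrum avoids 1, so \<open>1 / (1 - z)\<close> is a genuine inverse of
        the substitution.\<close>
      then have "z \<noteq> 1" using Re_Spec_generator[of z] by auto
      define w where "w = 1 / (1 - z)"
      have w: "w \<noteq> 0" "1 - 1 / w = z" using \<open>z \<noteq> 1\<close> by (simp_all add: w_def)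
      then have "w \<in> K" using 2(1) Spec_R_iff[OF w(1)] by (simp add: K_def)
      moreover have "g w = \<mu>" using w 2(2) by (simp add: g_def)
      ultimately show ?thesis by blast
    qed
  qed
  finally show ?thesis .
qed

end

lemma uniformly_bounded_bounded_semigroup:
  assumes "one_parameter_semigroup T" "uniformly_bounded T"
  obtains M where "bounded_semigroup T M"
proof -
  obtain M where M: "\<And>t. 0 \<le> t \<Longrightarrow> onorm (T t) \<le> M"
    using assms(2) by (auto simp: uniformly_bounded_def bdd_above_def)
  have T: "bounded_linear (T t)" if "0 \<le> t" for t
    using assms(1) that by (auto simp: one_parameter_semigroup_def bounded_clinear_def)
  have "bounded_semigroup T M"
  proof
    show "norm (T t x) \<le> M * norm x" if "0 \<le> t" for t x
      using onorm[OF T[OF that], of x] mult_right_mono[OF M[OF that] norm_ge_zero[of x]] by linarith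
    show "0 \<le> M"
      using onorm_pos_le[OF T[of 0]] M[of 0] by simp
  qed (fact assms(1))
  then show thesis by (rule that)
qed

theorem theorem32:
  fixes T :: "real \<Rightarrow> 'a::complex_banach \<Rightarrow> 'a"
    and f :: "real \<Rightarrow> complex"
  assumes "one_parameter_semigroup T"
    and "uniformly_bounded T"
    and "unbounded_operator (generator_domain T) (generator T)"
    and "f absolutely_integrable_on {0<..}"
  shows "(\<forall>x. (\<lambda>t. f t *\<^sub>C T t x) integrable_on {0<..}) \<and>
         bounded_clinear (semigroup_integral f T) \<and>
         Spec UNIV (semigroup_integral f T) =
           {0} \<union> {laplace_hat f z | z. z \<in> Spec (generator_domain T) (generator T)}"
proof -
  obtain M where "bounded_semigroup T M"
    using uniformly_bounded_bounded_semigroup assms(1,2) by blast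
  then interpret bounded_semigroup T M .
  show ?thesis
    using integrable_semigroup[OF assms(4)] bounded_clinear_semigroup_integral[OF assms(4)]
      Spec_X[OF assms(3,4)] app_X[OF assms(4)] by simp
qed

end
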